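(* Let $A$ be a balanced Hopf algebra over a field $\mathbb{F}$ with universal R-matrix $R$ and sovereign element $D$, let $B\subseteq A$ be a right coideal subalgebra, let $(\psi,J,K)$ be a cylindrical structure on $(A,B)$ with tensor K-matrix $\mathbb{K}$, and let $K'\in A^\times$ be such that $$\Delta(K')=J^{-1}\cdot(1\otimes K')\cdot R^\psi\cdot(K'\otimes1).$$ Then $\widetilde K:=D\cdot(K')^{-1}$ is a boundary gauge transformation for $(\psi,J)$ and yields a boundary transfer matrix $\mathscr{T}^{(V)}=\mathrm{Tr}_2\big(((1\otimes\widetilde K)\cdot\mathbb{K})_{\bullet,V}\big)$, i.e. $[V]\mapsto\mathscr{T}^{(V)}$ defines a ring homomorphism $[\mathrm{Mod}_{\mathsf{fd}}(A)]\to B$.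
   Context: Notation. $\mathrm{Ad}(a)(x)=axa^{-1}$. For $T\in A\otimes A$: $T_{21}$ is the flipped tensor, $T^\psi:=(\psi\otimes\mathrm{id})(T)$, $T^{\psi\psi}:=(\psi\otimes\psi)(T)$ for an algebra automorphism $\psi$; $T_{V,W}$ is the action on $V\otimes W$ and $T_{\bullet,V}\in A\otimes\mathrm{End}(V)$ is obtained by letting only the second leg act on $V$. $V^\psi$ is $V$ with $a$ acting as $\psi(a)_V$. $K_1=K\otimes1$, $K_2=1\otimes K$. For $\dim V<\infty$: $\mathrm{Tr}_2(a\otimes f)=\mathrm{Tr}(f)a$ and $(a\otimes f)^{\mathsf t_2}=a\otimes f^{\mathsf t}$. A Hopf algebra $A$ (coproduct $\Delta$, counit $\varepsilon$, invertible antipode $S$) is quasitriangular with $R\in(A\otimes A)^\times$ if $\mathrm{Ad}(R)\circ\Delta=\Delta^{\mathsf{op}}$, $(\Delta\otimes\mathrm{id})(R)=R_{13}R_{23}$, $(\mathrm{id}\otimes\Delta)(R)=R_{13}R_{12}$. It is balanced if there is a central $b\in A^\times$ with $\Delta(b)=(b\otimes b)R_{21}R$; equivalently there is a group-like $D\in A^\times$ (sovereign element) with $\mathrm{Ad}(D)=S^2$. A Drinfeld twist is $J\in(A\otimes A)^\times$ with $J_{12}(\Delta\otimes\mathrm{id})(J)=J_{23}(\mathrm{id}\otimes\Delta)(J)$ and $(\varepsilon\otimes\mathrm{id})(J)=1=(\mathrm{id}\otimes\varepsilon)(J)$. A twist pair $(\psi,J)$: an algebra automorphism $\psi$ and a Drinfeld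 twist $J$ with $(\psi\otimes\psi)\circ\Delta^{\mathsf{op}}\circ\psi^{-1}=\mathrm{Ad}(J)\circ\Delta$ and $(R^{\psi\psi})_{21}=J_{21}RJ^{-1}$. A right coideal subalgebra $B\subseteq A$ satisfies $\Delta(B)\subseteq B\otimes A$. A cylindrical structure on $(A,B)$ is $(\psi,J,K)$ with $(\psi,J)$ a twist pair and $K\in A^\times$ such that $\mathrm{Ad}(K)|_B=\psi|_B$, $(R^\psi)_{21}K_2R\in B\otimes A$, $\Delta(K)=J^{-1}K_2R^\psi K_1$. Its tensor K-matrix is $\mathbb{K}=(R^\psi)_{21}K_2R\in B\otimes A$. For $g\in A^\times$, set $\overline\psi=\mathrm{Ad}(g)\circ\psi$, $\overline J=(g\otimes g)J\Delta(g)^{-1}$. $g$ is a boundary gauge transformation for $(\psi,J)$ if $\overline J_{V,W}=(((R_{V^{\overline\psi},W}^{\ \mathsf t_2})^{-1})^{\mathsf t_2})^{-1}$ for all finite-dimensional $A$-modules $V,W$ (in particular the inverses exist). $[\mathrm{Mod}_{\mathsf{fd}}(A)]$ is the Grothendieck ring of finite-dimensional $A$-modules (relations from short exact sequences, product from $\otimes$). *)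

theory Defs
  imports
    "HOL-Algebra.Free_Abelian_Groups"
    "HOL-Algebra.QuotRing"
    "HOL-Algebra.Generated_Groups"
    "Jordan_Normal_Form.Matrix"
    "Jordan_Normal_Form.Matrix_Kernel"
begin

section \<open>Tensor products of vector spaces\<close>

text \<open>
  The free vector space on a set is the type of finitely supported functions.  The tensor product
  depends on the scalar multiplications, so it cannot be a type constructor; instead a type
  \<open>'t\<close> with a bilinear map into it is a tensor product if the canonical map from the free vector
  space on pairs identifies it with the quotient by the bilinearity relations.
  This determines it up to unique isomorphism; the usual universal property is derived below.
\<close>

abbreviation free_scale :: "'k::field \<Rightarrow> ('x \<Rightarrow>\<^sub>0 'k) \<Rightarrow> ('x \<Rightarrow>\<^sub>0 'k)" where
  "free_scale c \<equiv> Poly_Mapping.map ((*) c)"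

definition lincomb :: "('k::field \<Rightarrow> 'v::ab_group_add \<Rightarrow> 'v) \<Rightarrow> ('x \<Rightarrow> 'v) \<Rightarrow> ('x \<Rightarrow>\<^sub>0 'k) \<Rightarrow> 'v" where
  "lincomb s f p = (\<Sum>q\<in>Poly_Mapping.keys p. s (Poly_Mapping.lookup p q) (f q))"

definition bilinear_relators ::
  "('k::field \<Rightarrow> 'v::ab_group_add \<Rightarrow> 'v) \<Rightarrow> ('k \<Rightarrow> 'w::ab_group_add \<Rightarrow> 'w) \<Rightarrow> ('v \<times> 'w \<Rightarrow>\<^sub>0 'k) set" where
  "bilinear_relators s1 s2 =
     {Poly_Mapping.single (x + x', y) 1 - Poly_Mapping.single (x, y) 1
        - Poly_Mapping.single (x', y) 1 | x x' y. True}
   \<union> {Poly_Mapping.single (x, y + y') 1 - Poly_Mapping.single (x, y) 1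
        - Poly_Mapping.single (x, y') 1 | x y y'. True}
   \<union> {Poly_Mapping.single (s1 c x, y) 1 - Poly_Mapping.single (x, y) c | c x y. True}
   \<union> {Poly_Mapping.single (x, s2 c y) 1 - Poly_Mapping.single (x, y) c | c x y. True}"

definition bilin ::
  "('k::field \<Rightarrow> 'v::ab_group_add \<Rightarrow> 'v) \<Rightarrow> ('k \<Rightarrow> 'w::ab_group_add \<Rightarrow> 'w) \<Rightarrow>
   ('k \<Rightarrow> 'u::ab_group_add \<Rightarrow> 'u) \<Rightarrow> ('v \<Rightarrow> 'w \<Rightarrow> 'u) \<Rightarrow> bool" where
  "bilin s1 s2 s \<beta> \<longleftrightarrow>
     (\<forall>y. Vector_Spaces.linear s1 s (\<lambda>x. \<beta> x y)) \<and> (\<forall>x. Vector_Spaces.linear s2 s (\<beta> x))"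

locale tensor_product =
  V: vector_space s1 + W: vector_space s2 + T: vector_space sT
  for s1 :: "'k::field \<Rightarrow> 'v::ab_group_add \<Rightarrow> 'v"
    and s2 :: "'k \<Rightarrow> 'w::ab_group_add \<Rightarrow> 'w"
    and sT :: "'k \<Rightarrow> 't::ab_group_add \<Rightarrow> 't" +
  fixes ten :: "'v \<Rightarrow> 'w \<Rightarrow> 't"
  assumes bilin_ten: "bilin s1 s2 sT ten"
    and surj_ten: "surj (lincomb sT (\<lambda>(x, y). ten x y))"
    and kernel_ten: "lincomb sT (\<lambda>(x, y). ten x y) p = 0 \<Longrightarrow>
           p \<in> module.span free_scale (bilinear_relators s1 s2)"

text \<open>For bilinear \<open>\<beta>\<close> this is well defined by the universal property below.\<close>

definition tensor_lift ::
  "('k::field \<Rightarrow> 't::ab_group_add \<Rightarrow> 't) \<Rightarrow> ('v \<Rightarrow> 'w \<Rightarrow> 't) \<Rightarrow>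
   ('k \<Rightarrow> 'u::ab_group_add \<Rightarrow> 'u) \<Rightarrow> ('v \<Rightarrow> 'w \<Rightarrow> 'u) \<Rightarrow> 't \<Rightarrow> 'u" where
  "tensor_lift sT ten s \<beta> =
     (THE f. Vector_Spaces.linear sT s f \<and> (\<forall>x y. f (ten x y) = \<beta> x y))"

lemma lookup_free_scale: "Poly_Mapping.lookup (free_scale c p) q = c * Poly_Mapping.lookup p q"
  by (simp add: map.rep_eq when_def)

lemma vector_space_free: "vector_space (free_scale :: 'k::field \<Rightarrow> ('x \<Rightarrow>\<^sub>0 'k) \<Rightarrow> _)"
  by standard
    (rule poly_mapping_eqI; simp add: lookup_free_scale lookup_add distrib_left distrib_right)+

lemma lincomb_superset:
  assumes "vector_space s" "finite X" "Poly_Mapping.keys p \<subseteq> X"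
  shows "lincomb s f p = (\<Sum>q\<in>X. s (Poly_Mapping.lookup p q) (f q))"
proof -
  interpret vector_space s by fact
  show ?thesis unfolding lincomb_def
    by (rule sum.mono_neutral_left) (use assms(2,3) in \<open>auto simp: in_keys_iff\<close>)
qed

lemma linear_lincomb:
  fixes s :: "'k::field \<Rightarrow> 'v::ab_group_add \<Rightarrow> 'v" and f :: "'x \<Rightarrow> 'v"
  assumes "vector_space s"
  shows "Vector_Spaces.linear free_scale s (lincomb s f)"
proof -
  interpret S: vector_space s by fact
  interpret F: vector_space "free_scale :: 'k \<Rightarrow> ('x \<Rightarrow>\<^sub>0 'k) \<Rightarrow> _" by (rule vector_space_free)
  show ?thesis
  proof
    fix p q :: "'x \<Rightarrow>\<^sub>0 'k"
    let ?X = "Poly_Mapping.keys p \<union> Poly_Mapping.keys q \<union> Poly_Mapping.keys (p + q)"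
    have *: "lincomb s f r = (\<Sum>i\<in>?X. s (Poly_Mapping.lookup r i) (f i))"
      if "Poly_Mapping.keys r \<subseteq> ?X" for r
      by (rule lincomb_superset) (use that assms in auto)
    show "lincomb s f (p + q) = lincomb s f p + lincomb s f q"
      by (subst (1 2 3) *) (auto simp: lookup_add S.scale_left_distrib sum.distrib)
  next
    fix c :: 'k and p :: "'x \<Rightarrow>\<^sub>0 'k"
    have "Poly_Mapping.keys (free_scale c p) \<subseteq> Poly_Mapping.keys p"
      by (auto simp: in_keys_iff lookup_free_scale)
    then have "lincomb s f (free_scale c p)
        = (\<Sum>i\<in>Poly_Mapping.keys p. s (Poly_Mapping.lookup (free_scale c p) i) (f i))"
      by (intro lincomb_superset assms) auto
    also have "\<dots> = s c (lincomb s f p)"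
      by (simp add: lincomb_def S.scale_sum_right lookup_free_scale)
    finally show "lincomb s f (free_scale c p) = s c (lincomb s f p)" .
  qed
qed

lemma lincomb_single:
  assumes "vector_space s"
  shows "lincomb s f (Poly_Mapping.single q c) = s c (f q)"
proof -
  interpret vector_space s by fact
  show ?thesis by (simp add: lincomb_def)
qed

context tensor_product
begin

theorem universal_property:
  fixes s :: "'k \<Rightarrow> 'u::ab_group_add \<Rightarrow> 'u"
  assumes "vector_space s" and \<beta>: "bilin s1 s2 s \<beta>"
  shows "\<exists>!f. Vector_Spaces.linear sT s f \<and> (\<forall>x y. f (ten x y) = \<beta> x y)"
proof -
  interpret S: vector_space s by fact
  interpret F: vector_space "free_scale :: 'k \<Rightarrow> ('v \<times> 'w \<Rightarrow>\<^sub>0 'k) \<Rightarrow> _"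
    by (rule vector_space_free)
  let ?e = "lincomb sT (\<lambda>(x, y). ten x y)" and ?b = "lincomb s (\<lambda>(x, y). \<beta> x y)"
  interpret e: Vector_Spaces.linear free_scale sT ?e
    by (rule linear_lincomb) (rule T.vector_space_axioms)
  interpret b: Vector_Spaces.linear free_scale s ?b
    by (rule linear_lincomb) fact
  have lin1: "Vector_Spaces.linear s1 s (\<lambda>x. \<beta> x y)" for y using \<beta> by (simp add: bilin_def)
  have lin2: "Vector_Spaces.linear s2 s (\<beta> x)" for x using \<beta> by (simp add: bilin_def)
  have add1: "\<beta> (x + x') y = \<beta> x y + \<beta> x' y" for x x' y
    using module_hom.add[OF lin1[unfolded module_hom_iff_linear[symmetric]]] .
  have add2: "\<beta> x (y + y') = \<beta> x y + \<beta> x y'" for x y y'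
    using module_hom.add[OF lin2[unfolded module_hom_iff_linear[symmetric]]] .
  have sc1: "\<beta> (s1 c x) y = s c (\<beta> x y)" for c x y
    using module_hom.scale[OF lin1[unfolded module_hom_iff_linear[symmetric]]] .
  have sc2: "\<beta> x (s2 c y) = s c (\<beta> x y)" for c x y
    using module_hom.scale[OF lin2[unfolded module_hom_iff_linear[symmetric]]] .
  have rel: "?b p = 0" if "p \<in> bilinear_relators s1 s2" for p
    using that unfolding bilinear_relators_def
    by (auto simp: b.diff lincomb_single S.vector_space_axioms add1 add2 sc1 sc2)
  have ker: "?b p = 0" if "?e p = 0" for p
    using kernel_ten[OF that]
    by (induction rule: F.span_induct_alt) (auto simp: b.add b.scale rel)
  define f where "f t = ?b (inv_into UNIV ?e t)" for t
  have f: "f (?e p) = ?b p" for p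
  proof -
    have "?e (inv_into UNIV ?e (?e p) - p) = 0"
      by (simp add: e.diff surj_f_inv_f[OF surj_ten])
    from ker[OF this] show ?thesis by (simp add: f_def b.diff)
  qed
  have e_single: "?e (Poly_Mapping.single (x, y) 1) = ten x y" for x y
    by (simp add: lincomb_single T.vector_space_axioms)
  have b_single: "?b (Poly_Mapping.single (x, y) 1) = \<beta> x y" for x y
    by (simp add: lincomb_single S.vector_space_axioms)
  have "Vector_Spaces.linear sT s f"
  proof
    fix t u c
    obtain p q where "t = ?e p" "u = ?e q" using surj_ten by (metis surjD)
    then show "f (t + u) = f t + f u" by (metis e.add b.add f)
  next
    fix t c
    obtain p where "t = ?e p" using surj_ten by (metis surjD)
    then show "f (sT c t) = s c (f t)" by (metis e.scale b.scale f)
  qed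
  moreover have "f (ten x y) = \<beta> x y" for x y using f e_single b_single by metis
  moreover have "g = f" if g: "Vector_Spaces.linear sT s g" "\<forall>x y. g (ten x y) = \<beta> x y" for g
  proof
    fix t
    interpret g: Vector_Spaces.linear sT s g by (rule g)
    obtain p where p: "t = ?e p" using surj_ten by (metis surjD)
    have "g t = (\<Sum>q\<in>Poly_Mapping.keys p. s (Poly_Mapping.lookup p q) (case q of (x, y) \<Rightarrow> \<beta> x y))"
      unfolding p lincomb_def g.sum
      by (rule sum.cong) (auto simp: g.scale g(2) split: prod.splits)
    also have "\<dots> = f t" unfolding p f by (simp add: lincomb_def)
    finally show "g t = f t" .
  qed
  ultimately show ?thesis by blast
qed

lemma
  assumes "vector_space s" "bilin s1 s2 s \<beta>"
  shows linear_tensor_lift: "Vector_Spaces.linear sT s (tensor_lift sT ten s \<beta>)"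
    and tensor_lift_ten: "tensor_lift sT ten s \<beta> (ten x y) = \<beta> x y"
  using theI'[OF universal_property[OF assms]] by (simp_all add: tensor_lift_def)

end


section \<open>Algebras and their tensor products\<close>

definition invertible_elt :: "'a::monoid_mult \<Rightarrow> bool" where
  "invertible_elt x \<longleftrightarrow> (\<exists>y. x * y = 1 \<and> y * x = 1)"

definition elt_inverse :: "'a::monoid_mult \<Rightarrow> 'a" where
  "elt_inverse x = (THE y. x * y = 1 \<and> y * x = 1)"

definition Ad :: "'a::monoid_mult \<Rightarrow> 'a \<Rightarrow> 'a" where
  "Ad a x = a * x * elt_inverse a"

locale algebra_over_field = vector_space sc
  for sc :: "'k::field \<Rightarrow> 'a::ring_1 \<Rightarrow> 'a" +
  assumes scale_mult_left: "sc c x * y = sc c (x * y)"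
    and scale_mult_right: "x * sc c y = sc c (x * y)"

definition algebra_hom ::
  "('k::field \<Rightarrow> 'a::ring_1 \<Rightarrow> 'a) \<Rightarrow> ('k \<Rightarrow> 'b::ring_1 \<Rightarrow> 'b) \<Rightarrow> ('a \<Rightarrow> 'b) \<Rightarrow> bool" where
  "algebra_hom s1 s2 f \<longleftrightarrow>
     Vector_Spaces.linear s1 s2 f \<and> f 1 = 1 \<and> (\<forall>x y. f (x * y) = f x * f y)"

locale tensor_product_algebra =
  tensor_product s1 s2 sT ten +
  V: algebra_over_field s1 + W: algebra_over_field s2 + T: algebra_over_field sT
  for s1 :: "'k::field \<Rightarrow> 'a::ring_1 \<Rightarrow> 'a"
    and s2 :: "'k \<Rightarrow> 'b::ring_1 \<Rightarrow> 'b"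
    and sT :: "'k \<Rightarrow> 't::ring_1 \<Rightarrow> 't"
    and ten :: "'a \<Rightarrow> 'b \<Rightarrow> 't" +
  assumes ten_mult: "ten x y * ten x' y' = ten (x * x') (y * y')"
    and ten_one: "ten 1 1 = 1"


section \<open>Hopf algebras\<close>

text \<open>
  \<open>'a\<close> carries the algebra A, \<open>'b\<close> its tensor square, and \<open>'c\<close> its tensor cube, formed as
  the tensor product of the square with A.
\<close>

record ('k, 'a, 'b, 'c) hopf_data =
  scale1 :: "'k \<Rightarrow> 'a \<Rightarrow> 'a"
  scale2 :: "'k \<Rightarrow> 'b \<Rightarrow> 'b"
  scale3 :: "'k \<Rightarrow> 'c \<Rightarrow> 'c"
  tens2 :: "'a \<Rightarrow> 'a \<Rightarrow> 'b"
  tens21 :: "'b \<Rightarrow> 'a \<Rightarrow> 'c"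
  comult :: "'a \<Rightarrow> 'b"
  counit :: "'a \<Rightarrow> 'k"
  antipode :: "'a \<Rightarrow> 'a"

definition lift2 ::
  "('k::field, 'a::ring_1, 'b::ring_1, 'c::ring_1) hopf_data \<Rightarrow>
   ('k \<Rightarrow> 'u::ab_group_add \<Rightarrow> 'u) \<Rightarrow> ('a \<Rightarrow> 'a \<Rightarrow> 'u) \<Rightarrow> 'b \<Rightarrow> 'u" where
  "lift2 H = tensor_lift (scale2 H) (tens2 H)"

definition flip ::
  "('k::field, 'a::ring_1, 'b::ring_1, 'c::ring_1) hopf_data \<Rightarrow> 'b \<Rightarrow> 'b" where
  "flip H = lift2 H (scale2 H) (\<lambda>x y. tens2 H y x)"

definition tensor_map ::
  "('k::field, 'a::ring_1, 'b::ring_1, 'c::ring_1) hopf_data \<Rightarrow> ('a \<Rightarrow> 'a) \<Rightarrow> ('a \<Rightarrow> 'a) \<Rightarrow> 'b \<Rightarrow> 'b" where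
  "tensor_map H f g = lift2 H (scale2 H) (\<lambda>x y. tens2 H (f x) (g y))"

definition leg12 ::
  "('k::field, 'a::ring_1, 'b::ring_1, 'c::ring_1) hopf_data \<Rightarrow> 'b \<Rightarrow> 'c" where
  "leg12 H T = tens21 H T 1"

definition leg13 ::
  "('k::field, 'a::ring_1, 'b::ring_1, 'c::ring_1) hopf_data \<Rightarrow> 'b \<Rightarrow> 'c" where
  "leg13 H = lift2 H (scale3 H) (\<lambda>x y. tens21 H (tens2 H x 1) y)"

definition leg23 ::
  "('k::field, 'a::ring_1, 'b::ring_1, 'c::ring_1) hopf_data \<Rightarrow> 'b \<Rightarrow> 'c" where
  "leg23 H = lift2 H (scale3 H) (\<lambda>x y. tens21 H (tens2 H 1 x) y)"

definition comult_id ::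
  "('k::field, 'a::ring_1, 'b::ring_1, 'c::ring_1) hopf_data \<Rightarrow> 'b \<Rightarrow> 'c" where
  "comult_id H = lift2 H (scale3 H) (\<lambda>x y. tens21 H (comult H x) y)"

definition id_comult ::
  "('k::field, 'a::ring_1, 'b::ring_1, 'c::ring_1) hopf_data \<Rightarrow> 'b \<Rightarrow> 'c" where
  "id_comult H = lift2 H (scale3 H)
     (\<lambda>x y. lift2 H (scale3 H) (\<lambda>y1 y2. tens21 H (tens2 H x y1) y2) (comult H y))"

definition counit_id ::
  "('k::field, 'a::ring_1, 'b::ring_1, 'c::ring_1) hopf_data \<Rightarrow> 'b \<Rightarrow> 'a" where
  "counit_id H = lift2 H (scale1 H) (\<lambda>x y. scale1 H (counit H x) y)"

definition id_counit ::
  "('k::field, 'a::ring_1, 'b::ring_1, 'c::ring_1) hopf_data \<Rightarrow> 'b \<Rightarrow> 'a" where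
  "id_counit H = lift2 H (scale1 H) (\<lambda>x y. scale1 H (counit H y) x)"

locale hopf_algebra =
  fixes H :: "('k::field, 'a::ring_1, 'b::ring_1, 'c::ring_1) hopf_data"
  assumes tensor_square:
      "tensor_product_algebra (scale1 H) (scale1 H) (scale2 H) (tens2 H)"
    and tensor_cube:
      "tensor_product_algebra (scale2 H) (scale1 H) (scale3 H) (tens21 H)"
    and comult_hom: "algebra_hom (scale1 H) (scale2 H) (comult H)"
    and counit_hom: "algebra_hom (scale1 H) (*) (counit H)"
    and coassoc: "comult_id H (comult H x) = id_comult H (comult H x)"
    and counit_left: "counit_id H (comult H x) = x"
    and counit_right: "id_counit H (comult H x) = x"
    and antipode_linear: "Vector_Spaces.linear (scale1 H) (scale1 H) (antipode H)"
    and antipode_left: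
      "lift2 H (scale1 H) (\<lambda>x1 x2. antipode H x1 * x2) (comult H x) = scale1 H (counit H x) 1"
    and antipode_right:
      "lift2 H (scale1 H) (\<lambda>x1 x2. x1 * antipode H x2) (comult H x) = scale1 H (counit H x) 1"
    and antipode_bij: "bij (antipode H)"

locale quasitriangular_hopf_algebra = hopf_algebra H
  for H :: "('k::field, 'a::ring_1, 'b::ring_1, 'c::ring_1) hopf_data" +
  fixes R :: 'b
  assumes R_invertible: "invertible_elt R"
    and R_intertwines: "Ad R (comult H x) = flip H (comult H x)"
    and comult_id_R: "comult_id H R = leg13 H R * leg23 H R"
    and id_comult_R: "id_comult H R = leg13 H R * leg12 H R"

locale balanced_hopf_algebra = quasitriangular_hopf_algebra H R
  for H :: "('k::field, 'a::ring_1, 'b::ring_1, 'c::ring_1) hopf_data" and R :: 'b +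
  assumes balanced: "\<exists>b. invertible_elt b \<and> (\<forall>x. b * x = x * b) \<and>
    comult H b = tens2 H b b * flip H R * R"

definition sovereign_element ::
  "('k::field, 'a::ring_1, 'b::ring_1, 'c::ring_1) hopf_data \<Rightarrow> 'a \<Rightarrow> bool" where
  "sovereign_element H D \<longleftrightarrow>
     invertible_elt D \<and> comult H D = tens2 H D D \<and> (\<forall>x. Ad D x = antipode H (antipode H x))"


section \<open>Cylindrical structures\<close>

definition drinfeld_twist ::
  "('k::field, 'a::ring_1, 'b::ring_1, 'c::ring_1) hopf_data \<Rightarrow> 'b \<Rightarrow> bool" where
  "drinfeld_twist H J \<longleftrightarrow> invertible_elt J \<and>
     leg12 H J * comult_id H J = leg23 H J * id_comult H J \<and>
     counit_id H J = 1 \<and> id_counit H J = 1"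

definition twist_pair ::
  "('k::field, 'a::ring_1, 'b::ring_1, 'c::ring_1) hopf_data \<Rightarrow> 'b \<Rightarrow> ('a \<Rightarrow> 'a) \<Rightarrow> 'b \<Rightarrow> bool" where
  "twist_pair H R \<psi> J \<longleftrightarrow>
     algebra_hom (scale1 H) (scale1 H) \<psi> \<and> bij \<psi> \<and> drinfeld_twist H J \<and>
     (\<forall>x. tensor_map H \<psi> \<psi> (flip H (comult H (inv_into UNIV \<psi> x))) = Ad J (comult H x)) \<and>
     flip H (tensor_map H \<psi> \<psi> R) = flip H J * R * elt_inverse J"

definition tensor_with_A ::
  "('k::field, 'a::ring_1, 'b::ring_1, 'c::ring_1) hopf_data \<Rightarrow> 'a set \<Rightarrow> 'b set" where
  "tensor_with_A H B = module.span (scale2 H) {tens2 H b a | b a. b \<in> B}"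

definition right_coideal_subalgebra ::
  "('k::field, 'a::ring_1, 'b::ring_1, 'c::ring_1) hopf_data \<Rightarrow> 'a set \<Rightarrow> bool" where
  "right_coideal_subalgebra H B \<longleftrightarrow>
     module.subspace (scale1 H) B \<and> 1 \<in> B \<and> (\<forall>x\<in>B. \<forall>y\<in>B. x * y \<in> B) \<and>
     comult H ` B \<subseteq> tensor_with_A H B"

definition tensor_K_matrix ::
  "('k::field, 'a::ring_1, 'b::ring_1, 'c::ring_1) hopf_data \<Rightarrow> 'b \<Rightarrow> ('a \<Rightarrow> 'a) \<Rightarrow> 'a \<Rightarrow> 'b" where
  "tensor_K_matrix H R \<psi> K = flip H (tensor_map H \<psi> id R) * tens2 H 1 K * R"

definition cylindrical_structure ::
  "('k::field, 'a::ring_1, 'b::ring_1, 'c::ring_1) hopf_data \<Rightarrow> 'b \<Rightarrow> 'a set \<Rightarrow>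
   ('a \<Rightarrow> 'a) \<Rightarrow> 'b \<Rightarrow> 'a \<Rightarrow> bool" where
  "cylindrical_structure H R B \<psi> J K \<longleftrightarrow>
     twist_pair H R \<psi> J \<and> invertible_elt K \<and> (\<forall>b\<in>B. Ad K b = \<psi> b) \<and>
     tensor_K_matrix H R \<psi> K \<in> tensor_with_A H B \<and>
     comult H K = elt_inverse J * tens2 H 1 K * tensor_map H \<psi> id R * tens2 H K 1"


section \<open>Finite-dimensional modules\<close>

text \<open>
  A finite-dimensional module is given in coordinates, as a representation by \<open>n \<times> n\<close> matrices for
  an arbitrary \<open>n\<close> (including 0).  The matrix algebra of size \<open>n * m\<close> is the tensor product of
  those of sizes \<open>n\<close> and \<open>m\<close> through the Kronecker product, the basis vector
  \<open>e_i \<otimes> e_k\<close> having index \<open>i * m + k\<close>.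
\<close>

definition fd_module ::
  "('k::field, 'a::ring_1, 'b::ring_1, 'c::ring_1) hopf_data \<Rightarrow> ('a \<Rightarrow> 'k mat) \<Rightarrow> bool" where
  "fd_module H \<rho> \<longleftrightarrow> (\<exists>n. (\<forall>a. \<rho> a \<in> carrier_mat n n) \<and> \<rho> 1 = 1\<^sub>m n \<and>
     (\<forall>a b. \<rho> (a + b) = \<rho> a + \<rho> b) \<and> (\<forall>c a. \<rho> (scale1 H c a) = c \<cdot>\<^sub>m \<rho> a) \<and>
     (\<forall>a b. \<rho> (a * b) = \<rho> a * \<rho> b))"

definition mdim :: "('a::ring_1 \<Rightarrow> 'k mat) \<Rightarrow> nat" where
  "mdim \<rho> = dim_row (\<rho> 1)"

definition kronecker :: "'k::times mat \<Rightarrow> 'k mat \<Rightarrow> 'k mat" where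
  "kronecker X Y = mat (dim_row X * dim_row Y) (dim_col X * dim_col Y)
     (\<lambda>(r, c). X $$ (r div dim_row Y, c div dim_col Y) * Y $$ (r mod dim_row Y, c mod dim_col Y))"

text \<open>The action of \<open>T \<in> A \<otimes> A\<close> on \<open>V \<otimes> W\<close>; the linear extension is taken entrywise.\<close>

definition act2 ::
  "('k::field, 'a::ring_1, 'b::ring_1, 'c::ring_1) hopf_data \<Rightarrow>
   ('a \<Rightarrow> 'k mat) \<Rightarrow> ('a \<Rightarrow> 'k mat) \<Rightarrow> 'b \<Rightarrow> 'k mat" where
  "act2 H V W T = mat (mdim V * mdim W) (mdim V * mdim W)
     (\<lambda>(r, c). lift2 H (*) (\<lambda>x y. kronecker (V x) (W y) $$ (r, c)) T)"

text \<open>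
  \<open>T\<close> with only the second leg acting; \<open>A \<otimes> End(V)\<close> is the algebra of matrices over \<open>A\<close>.
\<close>

definition act_second ::
  "('k::field, 'a::ring_1, 'b::ring_1, 'c::ring_1) hopf_data \<Rightarrow> ('a \<Rightarrow> 'k mat) \<Rightarrow> 'b \<Rightarrow> 'a mat" where
  "act_second H V T = mat (mdim V) (mdim V)
     (\<lambda>(i, j). lift2 H (scale1 H) (\<lambda>x y. scale1 H (V y $$ (i, j)) x) T)"

definition partial_trace2 :: "'a::comm_monoid_add mat \<Rightarrow> 'a" where
  "partial_trace2 X = (\<Sum>i<dim_row X. X $$ (i, i))"

definition partial_transpose2 :: "nat \<Rightarrow> 'k mat \<Rightarrow> 'k mat" where
  "partial_transpose2 m X = mat (dim_row X) (dim_col X)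
     (\<lambda>(r, c). X $$ ((r div m) * m + c mod m, (c div m) * m + r mod m))"

definition is_inverse_mat :: "'k::field mat \<Rightarrow> 'k mat \<Rightarrow> bool" where
  "is_inverse_mat X Y \<longleftrightarrow> inverts_mat X Y \<and> inverts_mat Y X"

text \<open>
  The matrices \<open>X\<close> and \<open>Y\<close> are the inner and the outer inverse in
  \<open>(((R\<^sup>t\<^sup>2)\<^sup>-\<^sup>1)\<^sup>t\<^sup>2)\<^sup>-\<^sup>1\<close>.
\<close>

definition boundary_gauge_transformation ::
  "('k::field, 'a::ring_1, 'b::ring_1, 'c::ring_1) hopf_data \<Rightarrow> 'b \<Rightarrow>
   ('a \<Rightarrow> 'a) \<Rightarrow> 'b \<Rightarrow> 'a \<Rightarrow> bool" where
  "boundary_gauge_transformation H R \<psi> J g \<longleftrightarrow> invertible_elt g \<and>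
     (let \<psi>' = Ad g \<circ> \<psi>; J' = tens2 H g g * J * elt_inverse (comult H g) in
      \<forall>V W. fd_module H V \<longrightarrow> fd_module H W \<longrightarrow>
        (\<exists>X Y. is_inverse_mat (partial_transpose2 (mdim W) (act2 H (V \<circ> \<psi>') W R)) X \<and>
               is_inverse_mat (partial_transpose2 (mdim W) X) Y \<and>
               act2 H V W J' = Y))"

definition boundary_transfer_matrix ::
  "('k::field, 'a::ring_1, 'b::ring_1, 'c::ring_1) hopf_data \<Rightarrow> 'a \<Rightarrow> 'b \<Rightarrow> ('a \<Rightarrow> 'k mat) \<Rightarrow> 'a" where
  "boundary_transfer_matrix H g KK V = partial_trace2 (act_second H V (tens2 H 1 g * KK))"


section \<open>The Grothendieck ring\<close>

definition tensor_module ::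
  "('k::field, 'a::ring_1, 'b::ring_1, 'c::ring_1) hopf_data \<Rightarrow>
   ('a \<Rightarrow> 'k mat) \<Rightarrow> ('a \<Rightarrow> 'k mat) \<Rightarrow> 'a \<Rightarrow> 'k mat" where
  "tensor_module H V W a = act2 H V W (comult H a)"

definition trivial_module ::
  "('k::field, 'a::ring_1, 'b::ring_1, 'c::ring_1) hopf_data \<Rightarrow> 'a \<Rightarrow> 'k mat" where
  "trivial_module H a = counit H a \<cdot>\<^sub>m 1\<^sub>m 1"

definition short_exact ::
  "('k::field, 'a::ring_1, 'b::ring_1, 'c::ring_1) hopf_data \<Rightarrow>
   ('a \<Rightarrow> 'k mat) \<Rightarrow> ('a \<Rightarrow> 'k mat) \<Rightarrow> ('a \<Rightarrow> 'k mat) \<Rightarrow> bool" where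
  "short_exact H U V W \<longleftrightarrow> fd_module H U \<and> fd_module H V \<and> fd_module H W \<and>
     (\<exists>f\<in>carrier_mat (mdim V) (mdim U). \<exists>g\<in>carrier_mat (mdim W) (mdim V).
        (\<forall>a. f * U a = V a * f) \<and> (\<forall>a. g * V a = W a * g) \<and>
        inj_on ((*\<^sub>v) f) (carrier_vec (mdim U)) \<and>
        (*\<^sub>v) f ` carrier_vec (mdim U) = mat_kernel g \<and>
        (*\<^sub>v) g ` carrier_vec (mdim V) = carrier_vec (mdim W))"

text \<open>
  The free abelian group on the modules themselves is a ring because the Kronecker product is
  strictly associative and unital.  Isomorphic modules are identified by the exact sequences whose
  third term is the zero module.  The subgroup generated by the relations is an ideal because
  tensoring over a field is exact.
\<close>

definition free_module_ring ::
  "('k::field, 'a::ring_1, 'b::ring_1, 'c::ring_1) hopf_data \<Rightarrow> (('a \<Rightarrow> 'k mat) \<Rightarrow>\<^sub>0 int) ring" where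
  "free_module_ring H =
     \<lparr>carrier = carrier (free_Abelian_group {V. fd_module H V}),
      mult = (\<lambda>x y. \<Sum>V\<in>Poly_Mapping.keys x. \<Sum>W\<in>Poly_Mapping.keys y.
        Poly_Mapping.single (tensor_module H V W) (Poly_Mapping.lookup x V * Poly_Mapping.lookup y W)),
      one = Poly_Mapping.single (trivial_module H) 1,
      zero = 0,
      add = (+)\<rparr>"

definition exact_relations ::
  "('k::field, 'a::ring_1, 'b::ring_1, 'c::ring_1) hopf_data \<Rightarrow> (('a \<Rightarrow> 'k mat) \<Rightarrow>\<^sub>0 int) set" where
  "exact_relations H = generate (add_monoid (free_module_ring H))
     {Poly_Mapping.single V 1 - Poly_Mapping.single U 1 - Poly_Mapping.single W 1 | U V W.
        short_exact H U V W}"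

definition grothendieck_ring ::
  "('k::field, 'a::ring_1, 'b::ring_1, 'c::ring_1) hopf_data \<Rightarrow> (('a \<Rightarrow> 'k mat) \<Rightarrow>\<^sub>0 int) set ring" where
  "grothendieck_ring H = free_module_ring H Quot exact_relations H"

definition module_class ::
  "('k::field, 'a::ring_1, 'b::ring_1, 'c::ring_1) hopf_data \<Rightarrow> ('a \<Rightarrow> 'k mat) \<Rightarrow>
   (('a \<Rightarrow> 'k mat) \<Rightarrow>\<^sub>0 int) set" where
  "module_class H V = exact_relations H +>\<^bsub>free_module_ring H\<^esub> Poly_Mapping.single V 1"

definition subalgebra_ring :: "'a::ring_1 set \<Rightarrow> 'a ring" where
  "subalgebra_ring B = \<lparr>carrier = B, mult = (*), one = 1, zero = 0, add = (+)\<rparr>"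

end

theory Submission
  imports Defs
begin

text \<open>
  Put \<open>g = D K'\<^sup>-\<^sup>1\<close> and let \<open>\<psi>g = Ad(g) \<circ> \<psi>\<close>. The coproduct formula for \<open>K'\<close>, together with
  \<open>Ad(D) = S\<^sup>2\<close>, collapses the gauged twist to \<open>(\<psi>g \<otimes> S\<^sup>2)(R)\<close> (lemma \<open>gauged_J_eq\<close>).
  Write \<open>R = \<Sum> a\<^sub>i \<otimes> b\<^sub>i\<close>. Contracting \<open>(id \<otimes> \<Delta>)(R) = R\<^sub>1\<^sub>3 R\<^sub>1\<^sub>2\<close> with the antipode gives
  \<open>\<Sum> a\<^sub>i a\<^sub>j \<otimes> b\<^sub>j S(b\<^sub>i) = 1 = \<Sum> a\<^sub>i a\<^sub>j \<otimes> S(b\<^sub>j) b\<^sub>i\<close> (lemmas \<open>contract_right_R\<close> and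
  \<open>contract_left_R\<close>). Since \<open>S\<close> reverses products, these identities say that
  \<open>Q = (\<psi>g \<otimes> S)(R)\<close> is inverse to the gauged twist. Since transposition reverses products as well,
  they also say that the partial transposes of \<open>Q\<close> and of \<open>(\<psi>g \<otimes> id)(R)\<close> act on \<open>V \<otimes> W\<close> by mutually
  inverse matrices. Together this is the gauge condition.

  The transfer matrix of \<open>V\<close> is \<open>(id \<otimes> \<chi>)(Z)\<close>, where \<open>Z\<close> is \<open>(1 \<otimes> g)\<close> times the tensor K-matrix
  and \<open>\<chi>\<close> is the character of \<open>V\<close>. Hence it respects short exact sequences because characters do. For
  multiplicativity, the quasitriangularity axioms, the twist pair axioms and the Yang--Baxter equation
  give \<open>(id \<otimes> \<Delta>)(Z) = Q\<^sub>2\<^sub>3 Z\<^sub>1\<^sub>3 ((\<psi>g \<otimes> id)(R))\<^sub>2\<^sub>3 Z\<^sub>1\<^sub>2\<close> (lemma \<open>id_comult_gauged_K\<close>). Under a trace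
  over the last two legs the two R-matrices are brought together by cyclicity and cancel by the
  same contraction identity (lemma \<open>slice23_fused\<close>). The result is the product of the two
  transfer matrices in reversed order. The order does not matter in the end: conjugation
  by \<open>R\<close> exchanges \<open>\<Delta>\<close> and its opposite, so \<open>V \<otimes> W\<close> and \<open>W \<otimes> V\<close> have the same character.
  The unit is preserved because the counit takes the value 1 on \<open>D\<close>, \<open>K\<close> and \<open>K'\<close>.

  All identities between tensors are checked on pure tensors, which suffices by additivity.
\<close>

section \<open>Linear maps out of tensor products\<close>

lemma linear_addD: "Vector_Spaces.linear s s' f \<Longrightarrow> f (x + y) = f x + f y"
  by (simp add: Vector_Spaces.linear_iff)

lemma linear_scaleD: "Vector_Spaces.linear s s' f \<Longrightarrow> f (s c x) = s' c (f x)"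
  by (simp add: Vector_Spaces.linear_iff)

lemma linearI:
  assumes "vector_space s" "vector_space s'"
    "\<And>x y. f (x + y) = f x + f y" "\<And>c x. f (s c x) = s' c (f x)"
  shows "Vector_Spaces.linear s s' f"
  using assms by (simp add: Vector_Spaces.linear_iff)

lemma bilinI:
  assumes "vector_space s1" "vector_space s2" "vector_space s"
    "\<And>x x' y. \<beta> (x + x') y = \<beta> x y + \<beta> x' y" "\<And>c x y. \<beta> (s1 c x) y = s c (\<beta> x y)"
    "\<And>x y y'. \<beta> x (y + y') = \<beta> x y + \<beta> x y'" "\<And>c x y. \<beta> x (s2 c y) = s c (\<beta> x y)"
  shows "bilin s1 s2 s \<beta>"
  using assms by (simp add: bilin_def Vector_Spaces.linear_iff)

lemma bilin_vector_space: "bilin s1 s2 s \<beta> \<Longrightarrow> vector_space s"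
  by (simp add: bilin_def Vector_Spaces.linear_iff)

lemma bilinD:
  assumes "bilin s1 s2 s \<beta>"
  shows "\<beta> (x + x') y = \<beta> x y + \<beta> x' y" "\<beta> (s1 c x) y = s c (\<beta> x y)"
    "\<beta> x (y + y') = \<beta> x y + \<beta> x y'" "\<beta> x (s2 c y) = s c (\<beta> x y)"
  using assms by (simp_all add: bilin_def Vector_Spaces.linear_iff)

lemma vector_space_field: "vector_space ((*) :: 'k::field \<Rightarrow> 'k \<Rightarrow> 'k)"
  by standard (simp_all add: algebra_simps)

text \<open>A pure tensor absorbs its scalar coefficient, so every tensor is a sum of pure tensors
  and only additivity has to be checked.\<close>

lemma (in tensor_product) tensor_induct [case_names pure add]:
  assumes pure: "\<And>x y. P (ten x y)" and add: "\<And>t u. P t \<Longrightarrow> P u \<Longrightarrow> P (t + u)"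
  shows "P t"
proof -
  obtain p where p: "t = lincomb sT (\<lambda>(x, y). ten x y) p"
    using surj_ten by (metis surjD)
  have "P (\<Sum>q\<in>X. sT (Poly_Mapping.lookup p q) (case q of (x, y) \<Rightarrow> ten x y))" if "finite X" for X
    using that
  proof (induction X rule: finite_induct)
    case empty
    have "ten (0 + 0) 0 = ten 0 0 + ten 0 0"
      by (rule bilinD(1)[OF bilin_ten])
    then show ?case using pure[of 0 0] by simp
  next
    case (insert q X)
    obtain x y where q: "q = (x, y)" by (cases q)
    have "P (sT (Poly_Mapping.lookup p q) (ten x y))"
      using pure[of "s1 (Poly_Mapping.lookup p q) x" y] by (simp add: bilinD(2)[OF bilin_ten])
    with insert show ?case by (simp add: q add)
  qed
  then show ?thesis by (simp add: p lincomb_def)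
qed

context hopf_algebra
begin

sublocale Sq: tensor_product_algebra "scale1 H" "scale1 H" "scale2 H" "tens2 H"
  by (rule tensor_square)

sublocale Cu: tensor_product_algebra "scale2 H" "scale1 H" "scale3 H" "tens21 H"
  by (rule tensor_cube)

abbreviation sc where "sc \<equiv> scale1 H"
abbreviation ten (infixl "\<boxtimes>" 71) where "x \<boxtimes> y \<equiv> tens2 H x y"
abbreviation pure3 where "pure3 x y z \<equiv> tens21 H (tens2 H x y) z"
abbreviation comult_A ("\<Delta>") where "\<Delta> \<equiv> comult H"
abbreviation counit_A ("\<epsilon>") where "\<epsilon> \<equiv> counit H"
abbreviation antipode_A ("\<S>") where "\<S> \<equiv> antipode H"
abbreviation lin_A where "lin_A \<equiv> Vector_Spaces.linear (scale1 H) (scale1 H)"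

lemmas vector_spaces = Sq.V.vector_space_axioms Sq.T.vector_space_axioms Cu.T.vector_space_axioms
  vector_space_field

lemmas comult_linear = comult_hom[unfolded algebra_hom_def, THEN conjunct1]
lemmas counit_linear = counit_hom[unfolded algebra_hom_def, THEN conjunct1]

lemma comult_mult: "\<Delta> (x * y) = \<Delta> x * \<Delta> y" and comult_one: "\<Delta> 1 = 1"
  using comult_hom by (simp_all add: algebra_hom_def)

lemma counit_mult: "\<epsilon> (x * y) = \<epsilon> x * \<epsilon> y" and counit_one: "\<epsilon> 1 = 1"
  using counit_hom by (simp_all add: algebra_hom_def)

lemmas lin_simps =
  bilinD[OF Sq.bilin_ten] bilinD[OF Cu.bilin_ten]
  linear_addD[OF comult_linear] linear_scaleD[OF comult_linear]
  linear_addD[OF counit_linear] linear_scaleD[OF counit_linear]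
  linear_addD[OF antipode_linear] linear_scaleD[OF antipode_linear]
  Sq.V.scale_right_distrib Sq.V.scale_left_distrib Sq.V.scale_scale
  Sq.T.scale_right_distrib Sq.T.scale_left_distrib Sq.T.scale_scale
  Cu.T.scale_right_distrib Cu.T.scale_left_distrib Cu.T.scale_scale
  Sq.V.scale_mult_left Sq.V.scale_mult_right
  Sq.T.scale_mult_left Sq.T.scale_mult_right
  Cu.T.scale_mult_left Cu.T.scale_mult_right
  distrib_left distrib_right

lemmas ten_mults = Sq.ten_mult Cu.ten_mult

lemma cube_induct [case_names pure add]:
  assumes pure: "\<And>x y z. P (pure3 x y z)" and add: "\<And>t u. P t \<Longrightarrow> P u \<Longrightarrow> P (t + u)"
  shows "P t"
proof (induction t rule: Cu.tensor_induct)
  case (pure X z)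
  then show ?case
    by (induction X rule: Sq.tensor_induct) (simp_all add: assms bilinD[OF Cu.bilin_ten])
qed (rule add)

lemma lift2_ten: "bilin sc sc s \<beta> \<Longrightarrow> lift2 H s \<beta> (x \<boxtimes> y) = \<beta> x y"
  unfolding lift2_def by (rule Sq.tensor_lift_ten[OF bilin_vector_space])

lemma lift2_linear: "bilin sc sc s \<beta> \<Longrightarrow> Vector_Spaces.linear (scale2 H) s (lift2 H s \<beta>)"
  unfolding lift2_def by (rule Sq.linear_tensor_lift[OF bilin_vector_space])

lemmas lift2_add = linear_addD[OF lift2_linear]
lemmas lift2_scale = linear_scaleD[OF lift2_linear]

text \<open>This gives homomorphisms out of the tensor square without separate reasoning about sums of
  pure tensors; an analogue for the cube follows below.\<close>

lemma lift2_mult: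
  fixes \<beta> :: "'a \<Rightarrow> 'a \<Rightarrow> 'u::ring_1"
  assumes "bilin sc sc s \<beta>" "\<And>x y x' y'. \<beta> (x * x') (y * y') = \<beta> x y * \<beta> x' y'"
  shows "lift2 H s \<beta> (X * Y) = lift2 H s \<beta> X * lift2 H s \<beta> Y"
proof (induction X rule: Sq.tensor_induct)
  case (pure x y)
  show ?case
    by (induction Y rule: Sq.tensor_induct)
      (simp_all add: lift2_ten[OF assms(1)] lift2_add[OF assms(1)] assms(2) Sq.ten_mult distrib_left)
qed (simp_all add: lift2_add[OF assms(1)] distrib_right)

text \<open>The tensor cube is built as \<open>(A \<otimes> A) \<otimes> A\<close>; lifting trilinear maps in two stages
  hides that bracketing.\<close>

definition trilin :: "('k \<Rightarrow> 'u::ab_group_add \<Rightarrow> 'u) \<Rightarrow> ('a \<Rightarrow> 'a \<Rightarrow> 'a \<Rightarrow> 'u) \<Rightarrow> bool" where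
  "trilin s \<beta> \<longleftrightarrow> (\<forall>z. bilin sc sc s (\<lambda>x y. \<beta> x y z)) \<and> (\<forall>x y. Vector_Spaces.linear sc s (\<beta> x y))"

definition lift3 :: "('k \<Rightarrow> 'u::ab_group_add \<Rightarrow> 'u) \<Rightarrow> ('a \<Rightarrow> 'a \<Rightarrow> 'a \<Rightarrow> 'u) \<Rightarrow> 'c \<Rightarrow> 'u" where
  "lift3 s \<beta> = tensor_lift (scale3 H) (tens21 H) s (\<lambda>X z. lift2 H s (\<lambda>x y. \<beta> x y z) X)"

lemma trilinI:
  assumes "vector_space s"
    "\<And>x x' y z. \<beta> (x + x') y z = \<beta> x y z + \<beta> x' y z" "\<And>c x y z. \<beta> (sc c x) y z = s c (\<beta> x y z)"
    "\<And>x y y' z. \<beta> x (y + y') z = \<beta> x y z + \<beta> x y' z" "\<And>c x y z. \<beta> x (sc c y) z = s c (\<beta> x y z)"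
    "\<And>x y z z'. \<beta> x y (z + z') = \<beta> x y z + \<beta> x y z'" "\<And>c x y z. \<beta> x y (sc c z) = s c (\<beta> x y z)"
  shows "trilin s \<beta>"
  unfolding trilin_def using assms vector_spaces by (auto intro!: bilinI linearI)

lemma bilin_lift_trilin:
  assumes "trilin s \<beta>"
  shows "bilin (scale2 H) sc s (\<lambda>X z. lift2 H s (\<lambda>x y. \<beta> x y z) X)"
proof -
  have b: "bilin sc sc s (\<lambda>x y. \<beta> x y z)" for z
    using assms by (simp add: trilin_def)
  then interpret vector_space s by (rule bilin_vector_space)
  have l: "Vector_Spaces.linear sc s (\<beta> x y)" for x y
    using assms by (simp add: trilin_def)
  show ?thesis
  proof (rule bilinI)
    show "lift2 H s (\<lambda>x y. \<beta> x y (z + z')) X = lift2 H s (\<lambda>x y. \<beta> x y z) X + lift2 H s (\<lambda>x y. \<beta> x y z') X" for X z z'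
      by (induction X rule: Sq.tensor_induct)
        (simp_all only: lift2_ten[OF b] lift2_add[OF b] linear_addD[OF l, symmetric] add.assoc add.left_commute)
    show "lift2 H s (\<lambda>x y. \<beta> x y (sc c z)) X = s c (lift2 H s (\<lambda>x y. \<beta> x y z) X)" for X c z
      by (induction X rule: Sq.tensor_induct)
        (simp_all only: lift2_ten[OF b] lift2_add[OF b] linear_scaleD[OF l, symmetric] scale_right_distrib)
  qed (simp_all add: vector_spaces vector_space_axioms lift2_add[OF b] lift2_scale[OF b])
qed

lemma lift3_pure:
  assumes "trilin s \<beta>"
  shows "lift3 s \<beta> (pure3 x y z) = \<beta> x y z"
proof -
  have b: "bilin sc sc s (\<lambda>x y. \<beta> x y z)" for z
    using assms by (simp add: trilin_def)
  show ?thesis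
    using Cu.tensor_lift_ten[OF bilin_vector_space[OF b] bilin_lift_trilin[OF assms]]
    by (simp add: lift3_def lift2_ten[OF b])
qed

lemma lift3_linear: "trilin s \<beta> \<Longrightarrow> Vector_Spaces.linear (scale3 H) s (lift3 s \<beta>)"
  unfolding lift3_def
  by (intro Cu.linear_tensor_lift bilin_lift_trilin bilin_vector_space[OF bilin_lift_trilin])

lemmas lift3_add = linear_addD[OF lift3_linear]

lemma lift3_mult:
  fixes \<beta> :: "'a \<Rightarrow> 'a \<Rightarrow> 'a \<Rightarrow> 'u::ring_1"
  assumes "trilin s \<beta>" "\<And>x y z x' y' z'. \<beta> (x * x') (y * y') (z * z') = \<beta> x y z * \<beta> x' y' z'"
  shows "lift3 s \<beta> (X * Y) = lift3 s \<beta> X * lift3 s \<beta> Y"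
proof (induction X rule: cube_induct)
  case (pure x y z)
  show ?case
    by (induction Y rule: cube_induct)
      (simp_all add: lift3_pure[OF assms(1)] lift3_add[OF assms(1)] assms(2) ten_mults distrib_left)
qed (simp_all add: lift3_add[OF assms(1)] distrib_right)

section \<open>Leg notation and slices\<close>

abbreviation lin_form where "lin_form \<equiv> Vector_Spaces.linear (scale1 H) ((*) :: 'k \<Rightarrow> 'k \<Rightarrow> 'k)"

text \<open>\<open>put23 x Y\<close> stands for \<open>x \<otimes> Y\<close>, the tensor that the bracketing of the cube does not
  provide directly. It is multiplicative in both arguments jointly, so \<open>leg12\<close>, \<open>leg13\<close>, \<open>leg23\<close>
  and \<open>id \<otimes> \<Delta>\<close> of pure tensors can all be multiplied through it.\<close>

definition put23 :: "'a \<Rightarrow> 'b \<Rightarrow> 'c" where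
  "put23 x = lift2 H (scale3 H) (pure3 x)"

text \<open>The map \<open>id \<otimes> \<chi>\<close>. With \<open>\<chi>\<close> the character of a module it is the partial trace over that module,
  and with \<open>\<chi> = \<epsilon>\<close> it is the counit on the second leg.\<close>

definition slice :: "('a \<Rightarrow> 'k) \<Rightarrow> 'b \<Rightarrow> 'a" where
  "slice \<chi> = lift2 H sc (\<lambda>x y. sc (\<chi> y) x)"

definition pairing :: "('a \<Rightarrow> 'k) \<Rightarrow> ('a \<Rightarrow> 'k) \<Rightarrow> 'b \<Rightarrow> 'k" where
  "pairing \<chi> \<chi>' = lift2 H (*) (\<lambda>x y. \<chi> x * \<chi>' y)"

definition slice23 :: "('a \<Rightarrow> 'k) \<Rightarrow> ('a \<Rightarrow> 'k) \<Rightarrow> 'c \<Rightarrow> 'a" where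
  "slice23 \<chi> \<chi>' = lift3 sc (\<lambda>x y z. sc (\<chi> y * \<chi>' z) x)"

text \<open>These two contractions send \<open>x \<otimes> \<Delta>(y)\<close> to \<open>\<epsilon>(y) x \<otimes> 1\<close> by the antipode axioms. Applied to the
  two expressions for \<open>(id \<otimes> \<Delta>)(R)\<close> they let pairs of R-matrices cancel.\<close>

definition contract_right :: "'c \<Rightarrow> 'b" where
  "contract_right = lift3 (scale2 H) (\<lambda>x y z. x \<boxtimes> (y * \<S> z))"

definition contract_left :: "'c \<Rightarrow> 'b" where
  "contract_left = lift3 (scale2 H) (\<lambda>x y z. x \<boxtimes> (\<S> y * z))"

lemma bilin_flip: "bilin sc sc (scale2 H) (\<lambda>x y. y \<boxtimes> x)"
  by (rule bilinI) (simp_all add: lin_simps vector_spaces)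

lemmas flip_ten = lift2_ten[OF bilin_flip, folded flip_def]
lemmas flip_add = lift2_add[OF bilin_flip, folded flip_def]
lemmas flip_mult = lift2_mult[OF bilin_flip Sq.ten_mult[symmetric], folded flip_def]

lemma bilin_tensor_map:
  "lin_A f \<Longrightarrow> lin_A g \<Longrightarrow> bilin sc sc (scale2 H) (\<lambda>x y. f x \<boxtimes> g y)"
  by (rule bilinI) (simp_all add: lin_simps vector_spaces linear_addD[of sc sc] linear_scaleD[of sc sc])

lemma
  assumes "lin_A f" "lin_A g"
  shows tensor_map_ten: "tensor_map H f g (x \<boxtimes> y) = f x \<boxtimes> g y"
    and tensor_map_add: "tensor_map H f g (X + Y) = tensor_map H f g X + tensor_map H f g Y"
  using lift2_ten[OF bilin_tensor_map[OF assms]] lift2_add[OF bilin_tensor_map[OF assms]]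
  by (simp_all add: tensor_map_def)

lemma lin_id: "lin_A id"
  by (rule linearI) (simp_all add: vector_spaces)

text \<open>The identity is written as an abstraction because inductions over tensors produce it in this
  eta-expanded form.\<close>

lemma
  assumes "lin_A f"
  shows tensor_map_id_ten: "tensor_map H f (\<lambda>x. x) (x \<boxtimes> y) = f x \<boxtimes> y"
    and tensor_map_id_add:
      "tensor_map H f (\<lambda>x. x) (X + Y) = tensor_map H f (\<lambda>x. x) X + tensor_map H f (\<lambda>x. x) Y"
  using tensor_map_ten[OF assms lin_id] tensor_map_add[OF assms lin_id] by (simp_all add: id_def)

lemma leg12_ten: "leg12 H (x \<boxtimes> y) = pure3 x y 1"
  and leg12_add: "leg12 H (X + Y) = leg12 H X + leg12 H Y"
  and leg12_mult: "leg12 H (X * Y) = leg12 H X * leg12 H Y"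
  by (simp_all add: leg12_def lin_simps ten_mults)

lemma bilin_leg13: "bilin sc sc (scale3 H) (\<lambda>x y. pure3 x 1 y)"
  by (rule bilinI) (simp_all add: lin_simps vector_spaces)

lemmas leg13_ten = lift2_ten[OF bilin_leg13, folded leg13_def]
lemmas leg13_add = lift2_add[OF bilin_leg13, folded leg13_def]

lemma leg13_mult: "leg13 H (X * Y) = leg13 H X * leg13 H Y"
  unfolding leg13_def by (rule lift2_mult[OF bilin_leg13]) (simp add: ten_mults)

lemma bilin_put23: "bilin sc sc (scale3 H) (pure3 x)"
  by (rule bilinI) (simp_all add: lin_simps vector_spaces)

lemmas put23_ten = lift2_ten[OF bilin_put23, folded put23_def]
lemmas put23_add = lift2_add[OF bilin_put23, folded put23_def]
lemmas put23_scale = lift2_scale[OF bilin_put23, folded put23_def]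

lemma put23_add_left: "put23 (x + x') Y = put23 x Y + put23 x' Y"
  by (induction Y rule: Sq.tensor_induct) (simp_all add: put23_ten put23_add lin_simps)

lemma put23_scale_left: "put23 (sc c x) Y = scale3 H c (put23 x Y)"
  by (induction Y rule: Sq.tensor_induct) (simp_all add: put23_ten put23_add lin_simps)

lemma put23_mult: "put23 x X * put23 y Y = put23 (x * y) (X * Y)"
proof (induction X rule: Sq.tensor_induct)
  case (pure a b)
  show ?case
    by (induction Y rule: Sq.tensor_induct) (simp_all add: put23_ten put23_add ten_mults distrib_left)
qed (simp_all add: put23_add distrib_right)

lemma leg23_put23: "leg23 H X = put23 1 X"
  by (simp add: leg23_def put23_def)

lemma leg23_ten: "leg23 H (x \<boxtimes> y) = pure3 1 x y"
  and leg23_add: "leg23 H (X + Y) = leg23 H X + leg23 H Y"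
  and leg23_mult: "leg23 H (X * Y) = leg23 H X * leg23 H Y"
  by (simp_all add: leg23_put23 put23_ten put23_add put23_mult)

lemma bilin_comult_id: "bilin sc sc (scale3 H) (\<lambda>x y. tens21 H (\<Delta> x) y)"
  by (rule bilinI) (simp_all add: lin_simps vector_spaces)

lemmas comult_id_ten = lift2_ten[OF bilin_comult_id, folded comult_id_def]
lemmas comult_id_add = lift2_add[OF bilin_comult_id, folded comult_id_def]

lemma bilin_id_comult:
  "bilin sc sc (scale3 H) (\<lambda>x y. lift2 H (scale3 H) (pure3 x) (\<Delta> y))"
  unfolding put23_def[symmetric]
  by (rule bilinI) (simp_all add: lin_simps vector_spaces put23_add_left put23_scale_left put23_add put23_scale)

lemmas id_comult_ten = lift2_ten[OF bilin_id_comult, folded id_comult_def put23_def]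
lemmas id_comult_add = lift2_add[OF bilin_id_comult, folded id_comult_def]

lemma id_comult_mult: "id_comult H (X * Y) = id_comult H X * id_comult H Y"
  unfolding id_comult_def
  by (rule lift2_mult[OF bilin_id_comult])
    (simp add: comult_mult put23_mult flip: put23_def)

lemma bilin_slice: "lin_form \<chi> \<Longrightarrow> bilin sc sc sc (\<lambda>x y. sc (\<chi> y) x)"
  by (rule bilinI)
    (simp_all add: lin_simps vector_spaces linear_addD[of sc "(*)"] linear_scaleD[of sc "(*)"] mult.commute)

lemmas slice_ten = lift2_ten[OF bilin_slice, folded slice_def]
lemmas slice_add = lift2_add[OF bilin_slice, folded slice_def]
lemmas slice_scale = lift2_scale[OF bilin_slice, folded slice_def]

lemma bilin_pairing: "lin_form \<chi> \<Longrightarrow> lin_form \<chi>' \<Longrightarrow> bilin sc sc (*) (\<lambda>x y. \<chi> x * \<chi>' y)"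
  by (rule bilinI)
    (simp_all add: vector_spaces linear_addD[of sc "(*)"] linear_scaleD[of sc "(*)"] algebra_simps)

lemmas pairing_ten = lift2_ten[OF bilin_pairing, folded pairing_def]
lemmas pairing_add = lift2_add[OF bilin_pairing, folded pairing_def]
lemmas pairing_scale = lift2_scale[OF bilin_pairing, folded pairing_def]

lemma trilin_slice23:
  "lin_form \<chi> \<Longrightarrow> lin_form \<chi>' \<Longrightarrow> trilin sc (\<lambda>x y z. sc (\<chi> y * \<chi>' z) x)"
  by (rule trilinI)
    (simp_all add: lin_simps vector_spaces linear_addD[of sc "(*)"] linear_scaleD[of sc "(*)"] mult.commute mult.left_commute)

lemmas slice23_pure = lift3_pure[OF trilin_slice23, folded slice23_def]
lemmas slice23_add = lift3_add[OF trilin_slice23, folded slice23_def]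

lemma slice23_put23:
  assumes "lin_form \<chi>" "lin_form \<chi>'"
  shows "slice23 \<chi> \<chi>' (put23 x Y) = sc (pairing \<chi> \<chi>' Y) x"
  by (induction Y rule: Sq.tensor_induct)
    (simp_all add: slice23_pure slice23_add put23_ten put23_add pairing_ten pairing_add assms lin_simps)

lemma trilin_contract_right: "trilin (scale2 H) (\<lambda>x y z. x \<boxtimes> (y * \<S> z))"
  by (rule trilinI) (simp_all add: lin_simps vector_spaces)

lemmas contract_right_pure = lift3_pure[OF trilin_contract_right, folded contract_right_def]
lemmas contract_right_add = lift3_add[OF trilin_contract_right, folded contract_right_def]

lemma trilin_contract_left: "trilin (scale2 H) (\<lambda>x y z. x \<boxtimes> (\<S> y * z))"
  by (rule trilinI) (simp_all add: lin_simps vector_spaces)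

lemmas contract_left_pure = lift3_pure[OF trilin_contract_left, folded contract_left_def]
lemmas contract_left_add = lift3_add[OF trilin_contract_left, folded contract_left_def]

lemma id_counit_slice: "id_counit H = slice \<epsilon>"
  by (simp add: id_counit_def slice_def)

lemma id_counit_flip: "id_counit H (flip H X) = counit_id H X"
proof -
  have b: "bilin sc sc sc (\<lambda>x y. sc (\<epsilon> x) y)"
    by (rule bilinI) (simp_all add: lin_simps vector_spaces mult.commute)
  show ?thesis
    by (induction X rule: Sq.tensor_induct)
      (simp_all add: counit_id_def id_counit_slice slice_ten slice_add counit_linear flip_ten flip_add
        lift2_ten[OF b] lift2_add[OF b])
qed

lemma flip_flip: "flip H (flip H X) = X"
  by (induction X rule: Sq.tensor_induct) (simp_all add: flip_ten flip_add)

lemma id_counit_ten: "id_counit H (x \<boxtimes> y) = sc (\<epsilon> y) x"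
  and id_counit_add: "id_counit H (X + Y) = id_counit H X + id_counit H Y"
  by (simp_all add: id_counit_slice slice_ten slice_add counit_linear)

lemma id_counit_mult: "id_counit H (X * Y) = id_counit H X * id_counit H Y"
  unfolding id_counit_slice slice_def
  by (rule lift2_mult[OF bilin_slice[OF counit_linear]])
    (simp add: counit_mult lin_simps mult.commute)

lemma counit_id_mult: "counit_id H (X * Y) = counit_id H X * counit_id H Y"
  by (metis id_counit_flip id_counit_mult flip_mult)

lemma counit_id_ten: "counit_id H (x \<boxtimes> y) = sc (\<epsilon> x) y"
  by (metis id_counit_flip id_counit_ten flip_ten)

section \<open>The antipode\<close>

text \<open>If \<open>f * id = c \<epsilon>\<close> for the convolution product, then \<open>f = f * id * S = c S\<close>. The function \<open>G\<close> in
  the proof is \<open>x \<otimes> y \<otimes> z \<mapsto> f(x) y S(z)\<close>, evaluated on the two bracketings of the iterated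
  coproduct.\<close>

lemma antipode_unique:
  assumes f: "lin_A f" and conv: "\<And>x. lift2 H sc (\<lambda>x1 x2. f x1 * x2) (\<Delta> x) = sc (\<epsilon> x) c"
  shows "f x = c * \<S> x"
proof -
  note fl = linear_addD[OF f] linear_scaleD[OF f]
  have t: "trilin sc (\<lambda>x y z. f x * y * \<S> z)"
    by (rule trilinI) (simp_all add: lin_simps vector_spaces fl)
  have b1: "bilin sc sc sc (\<lambda>x1 x2. f x1 * x2)"
    by (rule bilinI) (simp_all add: lin_simps vector_spaces fl)
  have b2: "bilin sc sc sc (\<lambda>x1 x2. x1 * \<S> x2)"
    by (rule bilinI) (simp_all add: lin_simps vector_spaces)
  define G where "G = lift3 sc (\<lambda>x y z. f x * y * \<S> z)"
  have G_pure: "G (pure3 x y z) = f x * y * \<S> z" and G_add: "G (X + Y) = G X + G Y" for x y z X Y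
    by (simp_all add: G_def lift3_pure[OF t] lift3_add[OF t])
  have put: "G (put23 x Y) = f x * lift2 H sc (\<lambda>x1 x2. x1 * \<S> x2) Y" for x Y
    by (induction Y rule: Sq.tensor_induct)
      (simp_all add: G_pure G_add put23_ten put23_add lift2_ten[OF b2] lift2_add[OF b2]
        distrib_left mult.assoc)
  have "G (id_comult H X) = f (id_counit H X)" for X
    by (induction X rule: Sq.tensor_induct)
      (simp_all add: id_comult_ten id_comult_add put G_add id_counit_ten id_counit_add
        antipode_right fl lin_simps)
  then have 1: "G (id_comult H (\<Delta> x)) = f x"
    by (simp add: counit_right)
  have tens: "G (tens21 H X z) = lift2 H sc (\<lambda>x1 x2. f x1 * x2) X * \<S> z" for X z
    by (induction X rule: Sq.tensor_induct)
      (simp_all add: G_pure G_add lift2_ten[OF b1] lift2_add[OF b1] lin_simps)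
  have "G (comult_id H X) = c * \<S> (counit_id H X)" for X
  proof -
    have b: "bilin sc sc sc (\<lambda>x y. sc (\<epsilon> x) y)"
      by (rule bilinI) (simp_all add: lin_simps vector_spaces mult.commute)
    show ?thesis
      by (induction X rule: Sq.tensor_induct)
        (simp_all add: comult_id_ten comult_id_add tens G_add counit_id_ten conv lin_simps
          lift2_add[OF b] counit_id_def lift2_ten[OF b])
  qed
  then show ?thesis using 1 by (metis coassoc counit_left)
qed

text \<open>Fixing one argument at a time reduces anti-multiplicativity to two applications of the
  uniqueness of convolution inverses: first to \<open>y \<mapsto> \<Sum> S(x\<^sub>1 y) x\<^sub>2\<close>, then to
  \<open>x \<mapsto> S(x y)\<close>.\<close>

lemma antipode_mult: "\<S> (x * y) = \<S> y * \<S> x"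
proof -
  have b: "bilin sc sc sc (\<lambda>x1 x2. \<S> (x1 * y) * x2)" for y
    by (rule bilinI) (simp_all add: lin_simps vector_spaces)
  have bS: "bilin sc sc sc (\<lambda>x1 x2. \<S> x1 * x2)"
    by (rule bilinI) (simp_all add: lin_simps vector_spaces)
  define F where "F X y = lift2 H sc (\<lambda>x1 x2. \<S> (x1 * y) * x2) X" for X y
  have F_ten: "F (u \<boxtimes> v) y = \<S> (u * y) * v" and F_add: "F (X + Y) y = F X y + F Y y" for u v X Y y
    by (simp_all add: F_def lift2_ten[OF b] lift2_add[OF b])
  have Flin: "lin_A (F X)" for X
  proof (rule linearI)
    show "F X (y + y') = F X y + F X y'" for y y'
      by (induction X rule: Sq.tensor_induct) (simp_all add: F_ten F_add lin_simps)
    show "F X (sc c y) = sc c (F X y)" for y c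
      by (induction X rule: Sq.tensor_induct) (simp_all add: F_ten F_add lin_simps)
  qed (rule vector_spaces)+
  have bF: "bilin sc sc sc (\<lambda>x1 x2. F X x1 * x2)" for X
    by (rule bilinI) (simp_all add: lin_simps vector_spaces linear_addD[OF Flin] linear_scaleD[OF Flin])
  have *: "lift2 H sc (\<lambda>x1 x2. F X x1 * x2) Y = lift2 H sc (\<lambda>x1 x2. \<S> x1 * x2) (X * Y)" for X Y
  proof (induction Y rule: Sq.tensor_induct)
    case (pure u v)
    have "F X u * v = lift2 H sc (\<lambda>x1 x2. \<S> x1 * x2) (X * (u \<boxtimes> v))"
      by (induction X rule: Sq.tensor_induct)
        (simp_all add: F_ten F_add lift2_ten[OF bS] lift2_add[OF bS] Sq.ten_mult
          distrib_right mult.assoc)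
    then show ?case by (simp add: lift2_ten[OF bF])
  qed (simp_all add: lift2_add[OF bF] lift2_add[OF bS] distrib_left)
  have "F (\<Delta> x) y = sc (\<epsilon> x) 1 * \<S> y" for x y
    by (rule antipode_unique[OF Flin])
      (simp add: * antipode_left counit_mult lin_simps mult.commute flip: comult_mult)
  then have "lift2 H sc (\<lambda>x1 x2. \<S> (x1 * y) * x2) (\<Delta> x) = sc (\<epsilon> x) (\<S> y)" for x
    by (simp add: F_def lin_simps)
  then show ?thesis
    by (intro antipode_unique[where f = "\<lambda>x. \<S> (x * y)"])
      (auto intro!: linearI simp: lin_simps vector_spaces)
qed

lemma antipode_one: "\<S> 1 = 1"
proof -
  have b: "bilin sc sc sc (\<lambda>x1 x2. \<S> x1 * x2)"
    by (rule bilinI) (simp_all add: lin_simps vector_spaces)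
  have "lift2 H sc (\<lambda>x1 x2. \<S> x1 * x2) (1 \<boxtimes> 1) = sc (\<epsilon> 1) 1"
    using antipode_left[of 1] by (simp add: comult_one Sq.ten_one)
  then show ?thesis by (simp add: lift2_ten[OF b] counit_one)
qed

end

section \<open>Invertible elements\<close>

lemma elt_inverse_unique:
  fixes x :: "'a::monoid_mult"
  assumes "x * y = 1" "y * x = 1"
  shows "invertible_elt x" "elt_inverse x = y"
proof -
  show "invertible_elt x" using assms by (auto simp: invertible_elt_def)
  have "z = y" if "x * z = 1" "z * x = 1" for z
    by (metis assms(2) mult.assoc mult_1_left mult_1_right that(1))
  then show "elt_inverse x = y"
    unfolding elt_inverse_def using assms by blast
qed

lemma elt_inverse:
  fixes x :: "'a::monoid_mult"
  assumes "invertible_elt x"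
  shows "x * elt_inverse x = 1" "elt_inverse x * x = 1"
  using assms elt_inverse_unique(2)[of x] by (auto simp: invertible_elt_def)

lemma elt_inverse_cancel:
  fixes x :: "'a::monoid_mult"
  assumes "invertible_elt x"
  shows "x * (elt_inverse x * y) = y" "elt_inverse x * (x * y) = y"
    "y * x * elt_inverse x = y" "y * elt_inverse x * x = y"
  using elt_inverse[OF assms] by (simp_all flip: mult.assoc) (simp_all add: mult.assoc)

lemma Ad_mult:
  fixes x :: "'a::monoid_mult"
  assumes "invertible_elt a"
  shows "Ad a (x * y) = Ad a x * Ad a y"
  by (simp add: Ad_def mult.assoc elt_inverse_cancel[OF assms])

lemma Ad_intertwines:
  fixes x :: "'a::monoid_mult"
  assumes "invertible_elt a"
  shows "Ad a x * a = a * x"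
  by (simp add: Ad_def mult.assoc elt_inverse[OF assms])

context quasitriangular_hopf_algebra
begin

section \<open>The universal R-matrix\<close>

text \<open>Removing the third leg of \<open>(id \<otimes> \<Delta>)(R) = R\<^sub>1\<^sub>3 R\<^sub>1\<^sub>2\<close> with the counit yields
  \<open>R = ((id \<otimes> \<epsilon>)(R) \<otimes> 1) R\<close>, and \<open>R\<close> is invertible.\<close>

lemma id_counit_R: "id_counit H R = 1"
proof -
  define \<kappa> where "\<kappa> = lift3 (scale2 H) (\<lambda>x y z. scale2 H (\<epsilon> z) (x \<boxtimes> y))"
  have t: "trilin (scale2 H) (\<lambda>x y z. scale2 H (\<epsilon> z) (x \<boxtimes> y))"
    by (rule trilinI) (simp_all add: lin_simps vector_spaces mult.commute)
  have pure: "\<kappa> (pure3 x y z) = scale2 H (\<epsilon> z) (x \<boxtimes> y)" and add: "\<kappa> (X + Y) = \<kappa> X + \<kappa> Y" for x y z X Y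
    by (simp_all add: \<kappa>_def lift3_pure[OF t] lift3_add[OF t])
  have mult: "\<kappa> (X * Y) = \<kappa> X * \<kappa> Y" for X Y
    unfolding \<kappa>_def by (rule lift3_mult[OF t]) (simp add: counit_mult lin_simps ten_mults mult.commute)
  have "\<kappa> (put23 x Y) = x \<boxtimes> id_counit H Y" for x Y
    by (induction Y rule: Sq.tensor_induct)
      (simp_all add: put23_ten put23_add pure add id_counit_ten id_counit_add lin_simps)
  then have 1: "\<kappa> (id_comult H X) = X" for X
    by (induction X rule: Sq.tensor_induct) (simp_all add: id_comult_ten id_comult_add add counit_right)
  have 2: "\<kappa> (leg13 H X) = id_counit H X \<boxtimes> 1" for X
    by (induction X rule: Sq.tensor_induct)
      (simp_all add: leg13_ten leg13_add pure add id_counit_ten id_counit_add lin_simps)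
  have 3: "\<kappa> (leg12 H X) = X" for X
    by (induction X rule: Sq.tensor_induct) (simp_all add: leg12_ten leg12_add pure add counit_one)
  have "R = (id_counit H R \<boxtimes> 1) * R"
    using arg_cong[OF id_comult_R, of \<kappa>] by (simp add: 1 2 3 mult)
  then have "1 = (id_counit H R \<boxtimes> 1) * R * elt_inverse R"
    by (metis R_invertible elt_inverse(1))
  then have "1 = id_counit H R \<boxtimes> 1"
    by (simp add: elt_inverse_cancel[OF R_invertible])
  then have "id_counit H (1 \<boxtimes> 1) = id_counit H (id_counit H R \<boxtimes> 1)"
    by (simp add: Sq.ten_one)
  then show ?thesis by (simp add: id_counit_ten counit_one)
qed

text \<open>For \<open>R = \<Sum> a\<^sub>i \<otimes> b\<^sub>i\<close> the next two identities read
  \<open>\<Sum> a\<^sub>i a\<^sub>j \<otimes> b\<^sub>j S(b\<^sub>i) = 1\<close> and \<open>\<Sum> a\<^sub>i a\<^sub>j \<otimes> S(b\<^sub>j) b\<^sub>i = 1\<close>. Every cancellation of R-matrices in the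
  proof is an instance of one of them.\<close>

lemma contract_right_R: "contract_right (leg13 H R * leg12 H R) = 1"
proof -
  have b: "bilin sc sc sc (\<lambda>x1 x2. x1 * \<S> x2)"
    by (rule bilinI) (simp_all add: lin_simps vector_spaces)
  have "contract_right (put23 x Y) = x \<boxtimes> lift2 H sc (\<lambda>x1 x2. x1 * \<S> x2) Y" for x Y
    by (induction Y rule: Sq.tensor_induct)
      (simp_all add: put23_ten put23_add contract_right_pure contract_right_add lift2_ten[OF b] lift2_add[OF b] lin_simps)
  then have "contract_right (id_comult H X) = id_counit H X \<boxtimes> 1" for X
    by (induction X rule: Sq.tensor_induct)
      (simp_all add: id_comult_ten id_comult_add contract_right_add id_counit_ten id_counit_add antipode_right lin_simps)
  then show ?thesis
    by (simp add: id_counit_R Sq.ten_one flip: id_comult_R)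
qed

lemma contract_left_R: "contract_left (leg13 H R * leg12 H R) = 1"
proof -
  have b: "bilin sc sc sc (\<lambda>x1 x2. \<S> x1 * x2)"
    by (rule bilinI) (simp_all add: lin_simps vector_spaces)
  have "contract_left (put23 x Y) = x \<boxtimes> lift2 H sc (\<lambda>x1 x2. \<S> x1 * x2) Y" for x Y
    by (induction Y rule: Sq.tensor_induct)
      (simp_all add: put23_ten put23_add contract_left_pure contract_left_add lift2_ten[OF b] lift2_add[OF b] lin_simps)
  then have "contract_left (id_comult H X) = id_counit H X \<boxtimes> 1" for X
    by (induction X rule: Sq.tensor_induct)
      (simp_all add: id_comult_ten id_comult_add contract_left_add id_counit_ten id_counit_add antipode_left lin_simps)
  then show ?thesis
    by (simp add: id_counit_R Sq.ten_one flip: id_comult_R)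
qed

lemma R_comult: "R * \<Delta> x = flip H (\<Delta> x) * R"
  using Ad_intertwines[OF R_invertible] by (metis R_intertwines)

text \<open>Move \<open>R\<^sub>1\<^sub>2\<close> through \<open>(\<Delta> \<otimes> id)(R) = R\<^sub>1\<^sub>3 R\<^sub>2\<^sub>3\<close>: conjugation turns \<open>\<Delta>\<close> into its opposite, that is,
  it swaps the first two legs.\<close>

lemma yang_baxter: "leg12 H R * leg13 H R * leg23 H R = leg23 H R * leg13 H R * leg12 H R"
proof -
  define \<sigma> where "\<sigma> = lift3 (scale3 H) (\<lambda>x y z. pure3 y x z)"
  have t: "trilin (scale3 H) (\<lambda>x y z. pure3 y x z)"
    by (rule trilinI) (simp_all add: lin_simps vector_spaces)
  have pure: "\<sigma> (pure3 x y z) = pure3 y x z" and add: "\<sigma> (X + Y) = \<sigma> X + \<sigma> Y" for x y z X Y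
    by (simp_all add: \<sigma>_def lift3_pure[OF t] lift3_add[OF t])
  have mult: "\<sigma> (X * Y) = \<sigma> X * \<sigma> Y" for X Y
    unfolding \<sigma>_def by (rule lift3_mult[OF t]) (simp add: ten_mults)
  have tens: "\<sigma> (tens21 H X z) = tens21 H (flip H X) z" for X z
    by (induction X rule: Sq.tensor_induct) (simp_all add: pure add flip_ten flip_add lin_simps)
  have 1: "leg12 H R * comult_id H X = \<sigma> (comult_id H X) * leg12 H R" for X
    by (induction X rule: Sq.tensor_induct)
      (simp_all add: comult_id_ten comult_id_add add distrib_left distrib_right tens leg12_def Cu.ten_mult R_comult)
  have 2: "\<sigma> (leg13 H X) = leg23 H X" for X
    by (induction X rule: Sq.tensor_induct)
      (simp_all add: leg13_ten leg13_add leg23_ten leg23_add pure add)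
  have 3: "\<sigma> (leg23 H X) = leg13 H X" for X
    by (induction X rule: Sq.tensor_induct)
      (simp_all add: leg13_ten leg13_add leg23_ten leg23_add pure add)
  show ?thesis
    using 1[of R] by (simp add: comult_id_R mult 2 3 mult.assoc)
qed

lemma pairing_trace:
  assumes "lin_form \<chi>" "lin_form \<chi>'" "\<And>x y. \<chi> (x * y) = \<chi> (y * x)" "\<And>x y. \<chi>' (x * y) = \<chi>' (y * x)"
  shows "pairing \<chi> \<chi>' (X * Y) = pairing \<chi> \<chi>' (Y * X)"
proof (induction X rule: Sq.tensor_induct)
  case (pure a b)
  show ?case
    by (induction Y rule: Sq.tensor_induct)
      (simp_all add: pairing_ten pairing_add Sq.ten_mult distrib_left distrib_right assms(1,2) assms(3)[of a] assms(4)[of b])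
qed (simp_all add: pairing_add distrib_left distrib_right assms(1,2))

text \<open>Conjugation by \<open>R\<close> turns the coproduct into its opposite and is invisible to trace forms. Hence
  \<open>V \<otimes> W\<close> and \<open>W \<otimes> V\<close> have the same character.\<close>

lemma pairing_comult_commute:
  assumes "lin_form \<chi>" "lin_form \<chi>'" "\<And>x y. \<chi> (x * y) = \<chi> (y * x)" "\<And>x y. \<chi>' (x * y) = \<chi>' (y * x)"
  shows "pairing \<chi> \<chi>' (\<Delta> x) = pairing \<chi>' \<chi> (\<Delta> x)"
proof -
  have flip: "pairing \<chi>' \<chi> (flip H X) = pairing \<chi> \<chi>' X" for X
    by (induction X rule: Sq.tensor_induct) (simp_all add: flip_ten flip_add pairing_ten pairing_add assms(1,2))
  have "pairing \<chi> \<chi>' (flip H (\<Delta> x)) = pairing \<chi> \<chi>' (R * \<Delta> x * elt_inverse R)"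
    by (simp add: Ad_def flip: R_intertwines)
  also have "\<dots> = pairing \<chi> \<chi>' (elt_inverse R * (R * \<Delta> x))"
    by (rule pairing_trace[OF assms])
  finally show ?thesis using flip[of "flip H (\<Delta> x)"]
    by (simp add: elt_inverse_cancel[OF R_invertible] flip_flip)
qed

end

section \<open>Twist pairs and tensor K-matrices\<close>

locale twisted_hopf_algebra = quasitriangular_hopf_algebra H R
  for H :: "('k::field, 'a::ring_1, 'b::ring_1, 'c::ring_1) hopf_data" and R :: 'b +
  fixes \<psi> :: "'a \<Rightarrow> 'a" and J :: 'b
  assumes twist: "twist_pair H R \<psi> J"
begin

lemma psi_linear: "lin_A \<psi>" and psi_one: "\<psi> 1 = 1" and psi_mult: "\<psi> (x * y) = \<psi> x * \<psi> y"
  and psi_bij: "bij \<psi>" and J_invertible: "invertible_elt J"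
  and J_counit: "counit_id H J = 1" "id_counit H J = 1"
  using twist by (auto simp: twist_pair_def algebra_hom_def drinfeld_twist_def)

abbreviation R\<psi> where "R\<psi> \<equiv> tensor_map H \<psi> id R"

text \<open>The invertibility and the coproduct formula that \<open>K\<close> and \<open>K'\<close> have in common.\<close>

definition K_matrix :: "'a \<Rightarrow> bool" where
  "K_matrix K \<longleftrightarrow> invertible_elt K \<and>
     comult H K = elt_inverse J * tens2 H 1 K * R\<psi> * tens2 H K 1"

lemma J_comult_psi: "J * \<Delta> (\<psi> a) = tensor_map H \<psi> \<psi> (flip H (\<Delta> a)) * J"
proof -
  have "tensor_map H \<psi> \<psi> (flip H (\<Delta> (inv_into UNIV \<psi> (\<psi> a)))) = Ad J (\<Delta> (\<psi> a))"
    using twist unfolding twist_pair_def by blast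
  then have "tensor_map H \<psi> \<psi> (flip H (\<Delta> a)) = Ad J (\<Delta> (\<psi> a))"
    using psi_bij by (simp add: bij_is_inj)
  then show ?thesis using Ad_intertwines[OF J_invertible] by metis
qed

lemma J_comult_K:
  assumes "K_matrix K"
  shows "J * \<Delta> K = (1 \<boxtimes> K) * R\<psi> * (K \<boxtimes> 1)"
  using assms by (simp add: K_matrix_def mult.assoc elt_inverse_cancel[OF J_invertible])

text \<open>The image of the Yang--Baxter equation under the algebra homomorphism
  \<open>x \<otimes> y \<otimes> z \<mapsto> y \<otimes> \<psi>(x) \<otimes> z\<close>.\<close>

lemma mixed_yang_baxter:
  "leg12 H (flip H R\<psi>) * leg23 H R\<psi> * leg13 H R = leg13 H R * leg23 H R\<psi> * leg12 H (flip H R\<psi>)"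
proof -
  define \<sigma> where "\<sigma> = lift3 (scale3 H) (\<lambda>x y z. pure3 y (\<psi> x) z)"
  have t: "trilin (scale3 H) (\<lambda>x y z. pure3 y (\<psi> x) z)"
    by (rule trilinI) (simp_all add: lin_simps vector_spaces linear_addD[OF psi_linear] linear_scaleD[OF psi_linear])
  have pure: "\<sigma> (pure3 x y z) = pure3 y (\<psi> x) z" and add: "\<sigma> (X + Y) = \<sigma> X + \<sigma> Y" for x y z X Y
    by (simp_all add: \<sigma>_def lift3_pure[OF t] lift3_add[OF t])
  have mult: "\<sigma> (X * Y) = \<sigma> X * \<sigma> Y" for X Y
    unfolding \<sigma>_def by (rule lift3_mult[OF t]) (simp add: ten_mults psi_mult)
  note legs = leg12_ten leg12_add leg13_ten leg13_add leg23_ten leg23_add pure add psi_one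
    tensor_map_id_ten tensor_map_id_add psi_linear flip_ten flip_add
  have 1: "\<sigma> (leg12 H X) = leg12 H (flip H (tensor_map H \<psi> id X))" for X
    by (induction X rule: Sq.tensor_induct) (simp_all add: legs)
  have 2: "\<sigma> (leg13 H X) = leg23 H (tensor_map H \<psi> id X)" for X
    by (induction X rule: Sq.tensor_induct) (simp_all add: legs)
  have 3: "\<sigma> (leg23 H X) = leg13 H X" for X
    by (induction X rule: Sq.tensor_induct) (simp_all add: legs)
  show ?thesis
    using arg_cong[OF yang_baxter, of \<sigma>] by (simp add: mult 1 2 3)
qed

text \<open>The twist pair axiom replaces \<open>\<Delta> \<circ> \<psi>\<close> by \<open>(\<psi> \<otimes> \<psi>) \<circ> \<Delta>\<^sup>o\<^sup>p\<close> at the price of conjugating by \<open>J\<close>. What remains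
  is \<open>(\<Delta> \<otimes> id)(R) = R\<^sub>1\<^sub>3 R\<^sub>2\<^sub>3\<close> under the homomorphism \<open>\<tau>\<close> that reverses the legs and
  applies \<open>\<psi>\<close> to the last two.\<close>

lemma id_comult_flip_Rpsi:
  "leg23 H J * id_comult H (flip H R\<psi>) = leg13 H (flip H R\<psi>) * leg12 H (flip H R\<psi>) * leg23 H J"
proof -
  define \<tau> where "\<tau> = lift3 (scale3 H) (\<lambda>x y z. pure3 z (\<psi> y) (\<psi> x))"
  have t: "trilin (scale3 H) (\<lambda>x y z. pure3 z (\<psi> y) (\<psi> x))"
    by (rule trilinI) (simp_all add: lin_simps vector_spaces linear_addD[OF psi_linear] linear_scaleD[OF psi_linear])
  have pure: "\<tau> (pure3 x y z) = pure3 z (\<psi> y) (\<psi> x)" and add: "\<tau> (X + Y) = \<tau> X + \<tau> Y" for x y z X Y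
    by (simp_all add: \<tau>_def lift3_pure[OF t] lift3_add[OF t])
  have mult: "\<tau> (X * Y) = \<tau> X * \<tau> Y" for X Y
    unfolding \<tau>_def by (rule lift3_mult[OF t]) (simp add: ten_mults psi_mult)
  note legs = leg12_ten leg12_add leg13_ten leg13_add leg23_ten leg23_add pure add psi_one
    tensor_map_id_ten tensor_map_id_add psi_linear flip_ten flip_add
  have tens: "\<tau> (tens21 H X z) = put23 z (tensor_map H \<psi> \<psi> (flip H X))" for X z
    by (induction X rule: Sq.tensor_induct) (simp_all add: legs tensor_map_ten tensor_map_add put23_ten put23_add lin_simps)
  have 1: "leg23 H J * id_comult H (flip H (tensor_map H \<psi> id X)) = \<tau> (comult_id H X) * leg23 H J" for X
    by (induction X rule: Sq.tensor_induct)
      (simp_all add: tensor_map_id_ten tensor_map_id_add psi_linear flip_ten flip_add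
        id_comult_ten id_comult_add comult_id_ten comult_id_add
        tens add leg23_put23 put23_mult J_comult_psi distrib_left distrib_right)
  have 2: "\<tau> (leg13 H X) = leg13 H (flip H (tensor_map H \<psi> id X))" for X
    by (induction X rule: Sq.tensor_induct) (simp_all add: legs)
  have 3: "\<tau> (leg23 H X) = leg12 H (flip H (tensor_map H \<psi> id X))" for X
    by (induction X rule: Sq.tensor_induct) (simp_all add: legs)
  show ?thesis by (simp add: 1 comult_id_R mult 2 3)
qed

lemma leg3_commute: "leg12 H X * pure3 1 1 a = pure3 1 1 a * leg12 H X"
  by (induction X rule: Sq.tensor_induct)
    (simp_all add: leg12_ten leg12_add ten_mults distrib_left distrib_right)

lemma leg2_commute: "leg13 H X * pure3 1 a 1 = pure3 1 a 1 * leg13 H X"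
  by (induction X rule: Sq.tensor_induct)
    (simp_all add: leg13_ten leg13_add ten_mults distrib_left distrib_right)

text \<open>The coproduct formulas for the three factors of the tensor K-matrix produce its legs 12 and 13
  interleaved. The mixed Yang--Baxter equation separates them, leaving one R-matrix in between.\<close>

lemma id_comult_tensor_K_matrix:
  assumes "K_matrix K"
  shows "leg23 H J * id_comult H (tensor_K_matrix H R \<psi> K) =
    leg13 H (tensor_K_matrix H R \<psi> K) * leg23 H R\<psi> * leg12 H (tensor_K_matrix H R \<psi> K)"
proof -
  let ?P = "flip H R\<psi>" and ?K2 = "pure3 1 K 1" and ?K3 = "pure3 1 1 K"
  have "leg23 H J * id_comult H (tensor_K_matrix H R \<psi> K)
      = leg13 H ?P * leg12 H ?P * (leg23 H J * leg23 H (\<Delta> K)) * leg13 H R * leg12 H R"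
    by (simp add: tensor_K_matrix_def id_comult_mult id_comult_ten id_comult_R mult.assoc
        flip: leg23_put23) (simp add: id_comult_flip_Rpsi flip: mult.assoc)
  also have "\<dots> = leg13 H ?P * (leg12 H ?P * ?K3) * leg23 H R\<psi> * (?K2 * leg13 H R) * leg12 H R"
    by (simp add: J_comult_K[OF assms] leg23_mult leg23_ten mult.assoc flip: leg23_mult)
      (simp add: leg23_mult leg23_ten mult.assoc)
  also have "\<dots> = leg13 H ?P * ?K3 * (leg12 H ?P * leg23 H R\<psi> * leg13 H R) * ?K2 * leg12 H R"
    by (simp only: leg3_commute leg2_commute[symmetric] mult.assoc)
  also have "\<dots> = (leg13 H ?P * ?K3 * leg13 H R) * leg23 H R\<psi> * (leg12 H ?P * ?K2 * leg12 H R)"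
    by (simp only: mixed_yang_baxter) (simp only: mult.assoc)
  also have "\<dots> = leg13 H (tensor_K_matrix H R \<psi> K) * leg23 H R\<psi> * leg12 H (tensor_K_matrix H R \<psi> K)"
    by (simp add: tensor_K_matrix_def leg12_mult leg13_mult leg12_ten leg13_ten)
  finally show ?thesis .
qed

text \<open>Apply the counit to either leg of \<open>J \<Delta>(K) = K\<^sub>2 R\<^sup>\<psi> K\<^sub>1\<close>: the second leg determines \<open>\<epsilon>(K)\<close>, and
  then the first leg determines \<open>(\<epsilon> \<psi> \<otimes> id)(R)\<close>.\<close>

lemma K_matrix_counit:
  assumes "K_matrix K"
  shows "\<epsilon> K = 1" "counit_id H R\<psi> = 1"
proof -
  have inv: "invertible_elt K" using assms by (simp add: K_matrix_def)
  have *: "id_counit H (tensor_map H \<psi> id X) = \<psi> (id_counit H X)" for X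
    by (induction X rule: Sq.tensor_induct)
      (simp_all add: tensor_map_id_ten tensor_map_id_add psi_linear id_counit_ten id_counit_add
        linear_addD[OF psi_linear] linear_scaleD[OF psi_linear])
  have "K = sc (\<epsilon> K) 1 * K"
    using arg_cong[OF J_comult_K[OF assms], of "id_counit H"]
    by (simp add: id_counit_mult J_counit counit_right id_counit_ten * id_counit_R psi_one counit_one)
  then have "1 = sc (\<epsilon> K) 1"
    by (metis elt_inverse(1)[OF inv] elt_inverse_cancel(3)[OF inv])
  then have "\<epsilon> 1 = \<epsilon> (sc (\<epsilon> K) 1)" by simp
  then show 1: "\<epsilon> K = 1" by (simp add: lin_simps counit_one)
  have "K = K * counit_id H R\<psi>"
    using arg_cong[OF J_comult_K[OF assms], of "counit_id H"]
    by (simp add: counit_id_mult J_counit counit_left counit_id_ten 1 counit_one)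
  then show "counit_id H R\<psi> = 1"
    by (metis elt_inverse(2)[OF inv] elt_inverse_cancel(2)[OF inv])
qed

end

section \<open>Cancelling R-matrices with the antipode\<close>

context hopf_algebra
begin

lemma tensor_induct2 [case_names pure add_left add_right]:
  assumes "\<And>x y x' y'. P (x \<boxtimes> y) (x' \<boxtimes> y')"
    and "\<And>X X' Y. P X Y \<Longrightarrow> P X' Y \<Longrightarrow> P (X + X') Y"
    and "\<And>X Y Y'. P X Y \<Longrightarrow> P X Y' \<Longrightarrow> P X (Y + Y')"
  shows "P X Y"
proof (induction X rule: Sq.tensor_induct)
  case (pure x y)
  then show ?case by (induction Y rule: Sq.tensor_induct) (rule assms | assumption)+
qed (rule assms(2))

lemma lin_antipode_sq: "lin_A (\<lambda>x. \<S> (\<S> x))"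
  by (rule linearI) (simp_all add: lin_simps vector_spaces)

text \<open>Because \<open>S\<close> reverses products, the product on the left is \<open>f \<otimes> S\<close> of a contraction. For
  \<open>X = Y = R\<close> these two lemmas make \<open>(f \<otimes> S)(R)\<close> and \<open>(f \<otimes> S\<^sup>2)(R)\<close> mutually inverse.\<close>

lemma antipode_contract_right:
  assumes f: "lin_A f" and f_mult: "\<And>x y. f (x * y) = f x * f y"
  shows "tensor_map H f (\<lambda>x. \<S> (\<S> x)) X * tensor_map H f \<S> Y
    = tensor_map H f \<S> (contract_right (leg13 H X * leg12 H Y))"
  by (induction X Y rule: tensor_induct2)
    (simp_all add: tensor_map_ten tensor_map_add f lin_antipode_sq antipode_linear f_mult Sq.ten_mult
      leg13_ten leg13_add leg12_ten leg12_add contract_right_pure contract_right_add ten_mults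
      antipode_mult distrib_left distrib_right)

lemma antipode_contract_left:
  assumes f: "lin_A f" and f_mult: "\<And>x y. f (x * y) = f x * f y"
  shows "tensor_map H f \<S> X * tensor_map H f (\<lambda>x. \<S> (\<S> x)) Y
    = tensor_map H f \<S> (contract_left (leg13 H X * leg12 H Y))"
  by (induction X Y rule: tensor_induct2)
    (simp_all add: tensor_map_ten tensor_map_add f lin_antipode_sq antipode_linear f_mult Sq.ten_mult
      leg13_ten leg13_add leg12_ten leg12_add contract_left_pure contract_left_add ten_mults
      antipode_mult distrib_left distrib_right)

definition trace_form :: "('a \<Rightarrow> 'k) \<Rightarrow> bool" where
  "trace_form \<chi> \<longleftrightarrow> lin_form \<chi> \<and> (\<forall>x y. \<chi> (x * y) = \<chi> (y * x))"

text \<open>Under a trace the last factor of the second leg may be moved to the front, where it meets the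
  antipode: \<open>\<chi>'(S(z) l y) = \<chi>'(y S(z) l)\<close>. This is what makes the two R-matrices cancel although
  \<open>l\<close> stands between them.\<close>

lemma pairing_contract_right:
  assumes \<chi>: "lin_form \<chi>" and \<chi>': "trace_form \<chi>'"
    and f: "lin_A f" and f_mult: "\<And>x y. f (x * y) = f x * f y"
  shows "pairing \<chi> \<chi>' (tensor_map H f \<S> X * (1 \<boxtimes> l) * tensor_map H f id Y * (l' \<boxtimes> 1))
    = pairing (\<lambda>x. \<chi> (f x * l')) (\<lambda>y. \<chi>' (y * l)) (contract_right (leg13 H X * leg12 H Y))"
proof -
  have l: "lin_form \<chi>'" and tr: "\<chi>' (x * y) = \<chi>' (y * x)" for x y
    using \<chi>' by (auto simp: trace_form_def)
  have l1: "lin_form (\<lambda>x. \<chi> (f x * l'))"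
    by (rule linearI) (simp_all add: vector_spaces lin_simps linear_addD[OF f] linear_scaleD[OF f]
        linear_addD[OF \<chi>] linear_scaleD[OF \<chi>])
  have l2: "lin_form (\<lambda>y. \<chi>' (y * l))"
    by (rule linearI) (simp_all add: vector_spaces lin_simps linear_addD[OF l] linear_scaleD[OF l])
  show ?thesis
  proof (induction X Y rule: tensor_induct2)
    case (pure x z x' y)
    have "\<chi>' (\<S> z * l * y) = \<chi>' (y * \<S> z * l)"
      using tr[of "\<S> z * l" y] by (simp add: mult.assoc)
    then show ?case
      by (simp add: tensor_map_ten tensor_map_id_ten f antipode_linear f_mult ten_mults
        pairing_ten \<chi> l l1 l2 leg13_ten leg12_ten contract_right_pure)
  qed (simp_all add: tensor_map_add tensor_map_id_add f antipode_linear pairing_add \<chi> l l1 l2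
      leg13_add leg12_add contract_right_add distrib_left distrib_right)
qed

lemma lin_pairing_comult:
  assumes "lin_form \<chi>" "lin_form \<chi>'"
  shows "lin_form (\<lambda>y. pairing \<chi> \<chi>' (\<Delta> y))"
  by (rule linearI) (simp_all add: vector_spaces lin_simps pairing_add pairing_scale assms)

lemma slice_convolution:
  assumes "lin_form \<chi>" "lin_form \<chi>'"
  shows "slice (\<lambda>y. pairing \<chi> \<chi>' (\<Delta> y)) Z = slice23 \<chi> \<chi>' (id_comult H Z)"
  by (induction Z rule: Sq.tensor_induct)
    (simp_all add: slice_ten slice_add lin_pairing_comult assms id_comult_ten id_comult_add
      slice23_put23 slice23_add)

lemma slice_mem:
  assumes B: "right_coideal_subalgebra H B" and X: "X \<in> tensor_with_A H B" and \<chi>: "lin_form \<chi>"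
  shows "slice \<chi> ((1 \<boxtimes> a) * X) \<in> B"
proof -
  have sub: "Sq.V.subspace B" using B by (simp add: right_coideal_subalgebra_def)
  have "Sq.T.subspace {X. slice \<chi> ((1 \<boxtimes> a) * X) \<in> B}"
    unfolding Sq.T.subspace_def
  proof (intro conjI allI ballI)
    have "slice \<chi> (0 + 0) = slice \<chi> 0 + slice \<chi> 0" by (rule slice_add[OF \<chi>])
    then show "0 \<in> {X. slice \<chi> ((1 \<boxtimes> a) * X) \<in> B}" using Sq.V.subspace_0[OF sub] by simp
  qed (auto simp: distrib_left slice_add slice_scale lin_simps \<chi>
      intro: Sq.V.subspace_add[OF sub] Sq.V.subspace_scale[OF sub])
  moreover have "slice \<chi> ((1 \<boxtimes> a) * (b \<boxtimes> c)) \<in> B" if "b \<in> B" for b c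
    using Sq.V.subspace_scale[OF sub that] by (simp add: Sq.ten_mult slice_ten \<chi>)
  ultimately show ?thesis
    using X Sq.T.span_minimal[of "{tens2 H b a | b a. b \<in> B}" "{X. slice \<chi> ((1 \<boxtimes> a) * X) \<in> B}"]
    unfolding tensor_with_A_def by auto
qed

end

section \<open>The gauged twist and the fusion of transfer matrices\<close>

locale boundary_hopf_algebra = twisted_hopf_algebra H R \<psi> J
  for H :: "('k::field, 'a::ring_1, 'b::ring_1, 'c::ring_1) hopf_data" and R :: 'b
    and \<psi> :: "'a \<Rightarrow> 'a" and J :: 'b +
  fixes D K' :: 'a
  assumes D: "sovereign_element H D" and K': "K_matrix K'"
begin

text \<open>The element \<open>g\<close> is the boundary gauge transformation of the statement, and \<open>\<psi>g\<close> the gauged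
  automorphism. \<open>Q\<close> will be the inverse of the gauged twist.\<close>

definition g where "g = D * elt_inverse K'"
definition \<psi>g where "\<psi>g = Ad g \<circ> \<psi>"
abbreviation Q where "Q \<equiv> tensor_map H \<psi>g \<S> R"

lemma D_invertible: "invertible_elt D" and D_grouplike: "\<Delta> D = D \<boxtimes> D"
  and D_antipode: "D * x = \<S> (\<S> x) * D"
  using D Ad_intertwines[of D x] by (simp_all add: sovereign_element_def)

lemma K'_invertible: "invertible_elt K'"
  using K' by (simp add: K_matrix_def)

lemma g_K': "g * K' = D"
  by (simp add: g_def elt_inverse_cancel[OF K'_invertible])

lemma g_invertible: "invertible_elt g"
  by (rule elt_inverse_unique(1)[of _ "K' * elt_inverse D"])
    (simp_all add: g_def mult.assoc elt_inverse_cancel[OF K'_invertible] elt_inverse_cancel[OF D_invertible]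
      elt_inverse[OF D_invertible] elt_inverse[OF K'_invertible])

lemma psi_g: "\<psi>g x * g = g * \<psi> x"
  by (simp add: \<psi>g_def Ad_intertwines[OF g_invertible])

lemma psi_g_linear: "lin_A \<psi>g"
  by (rule linearI)
    (simp_all add: vector_spaces \<psi>g_def Ad_def lin_simps linear_addD[OF psi_linear] linear_scaleD[OF psi_linear])

lemma psi_g_mult: "\<psi>g (x * y) = \<psi>g x * \<psi>g y"
  by (simp add: \<psi>g_def psi_mult Ad_mult[OF g_invertible])

lemma psi_g_one: "\<psi>g 1 = 1"
  by (simp add: \<psi>g_def psi_one Ad_def elt_inverse[OF g_invertible])

text \<open>Multiplied by \<open>\<Delta>(K')\<close>, the coproduct formula for \<open>K'\<close> eliminates \<open>J\<close>, and \<open>g K' = D\<close> leaves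
  \<open>R\<^sup>\<psi>\<close> conjugated by \<open>g \<otimes> D\<close>. The conjugation by \<open>D\<close> is \<open>S\<^sup>2\<close>.\<close>

lemma gauged_J: "tensor_map H \<psi>g (\<lambda>x. \<S> (\<S> x)) R * \<Delta> g = (g \<boxtimes> g) * J"
proof -
  let ?L = "tensor_map H \<psi>g (\<lambda>x. \<S> (\<S> x)) R"
  have inv: "invertible_elt (\<Delta> K')"
    by (rule elt_inverse_unique(1)[of _ "\<Delta> (elt_inverse K')"])
      (simp_all flip: comult_mult add: elt_inverse[OF K'_invertible] comult_one)
  have *: "tensor_map H \<psi>g (\<lambda>x. \<S> (\<S> x)) X * (g \<boxtimes> D) = (g \<boxtimes> D) * tensor_map H \<psi> id X" for X
    by (induction X rule: Sq.tensor_induct)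
      (simp_all add: tensor_map_ten tensor_map_add tensor_map_id_ten tensor_map_id_add psi_g_linear
        psi_linear lin_antipode_sq Sq.ten_mult psi_g D_antipode distrib_left distrib_right)
  have "(g \<boxtimes> g) * J * \<Delta> K' = (g \<boxtimes> D) * R\<psi> * (K' \<boxtimes> 1)"
    by (simp add: J_comult_K[OF K'] mult.assoc) (simp add: Sq.ten_mult g_K' flip: mult.assoc)
  also have "\<dots> = ?L * (D \<boxtimes> D)"
    by (simp add: mult.assoc Sq.ten_mult g_K' flip: *)
  also have "\<dots> = ?L * \<Delta> g * \<Delta> K'"
    by (simp add: mult.assoc g_K' D_grouplike flip: comult_mult)
  finally show ?thesis
    by (metis elt_inverse_cancel(3)[OF inv])
qed

lemma gauged_J_inverse:
  "tensor_map H \<psi>g (\<lambda>x. \<S> (\<S> x)) R * Q = 1" "Q * tensor_map H \<psi>g (\<lambda>x. \<S> (\<S> x)) R = 1"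
proof -
  have 1: "tensor_map H \<psi>g \<S> 1 = 1"
    using tensor_map_ten[OF psi_g_linear antipode_linear, of 1 1]
    by (simp add: Sq.ten_one antipode_one psi_g_one)
  show "tensor_map H \<psi>g (\<lambda>x. \<S> (\<S> x)) R * Q = 1"
    by (subst antipode_contract_right[OF psi_g_linear psi_g_mult]) (simp add: contract_right_R 1)
  show "Q * tensor_map H \<psi>g (\<lambda>x. \<S> (\<S> x)) R = 1"
    by (subst antipode_contract_left[OF psi_g_linear psi_g_mult]) (simp add: contract_left_R 1)
qed

lemma gauged_J_eq: "(g \<boxtimes> g) * J * elt_inverse (\<Delta> g) = tensor_map H \<psi>g (\<lambda>x. \<S> (\<S> x)) R"
proof -
  have inv: "invertible_elt (\<Delta> g)"
    by (rule elt_inverse_unique(1)[of _ "\<Delta> (elt_inverse g)"])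
      (simp_all flip: comult_mult add: elt_inverse[OF g_invertible] comult_one)
  show ?thesis by (simp add: elt_inverse_cancel[OF inv] flip: gauged_J)
qed

lemma comult_g: "\<Delta> g = Q * (g \<boxtimes> g) * J"
  using arg_cong[OF gauged_J, of "(*) Q"] by (simp add: gauged_J_inverse mult.assoc[symmetric])

definition transfer_matrix :: "'a \<Rightarrow> ('a \<Rightarrow> 'k) \<Rightarrow> 'a" where
  "transfer_matrix K \<chi> = slice \<chi> ((1 \<boxtimes> g) * tensor_K_matrix H R \<psi> K)"

text \<open>The twist \<open>J\<close> of the coproduct formula for the tensor K-matrix is absorbed by
  \<open>\<Delta>(g) = Q (g \<otimes> g) J\<close>, and moving \<open>g\<^sub>2\<close> past \<open>R\<^sup>\<psi>\<^sub>2\<^sub>3\<close> turns \<open>\<psi>\<close> into the gauged automorphism.\<close>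

lemma id_comult_gauged_K:
  assumes "K_matrix K"
  defines "Z \<equiv> (1 \<boxtimes> g) * tensor_K_matrix H R \<psi> K"
  shows "id_comult H Z = leg23 H Q * leg13 H Z * leg23 H (tensor_map H \<psi>g id R) * leg12 H Z"
proof -
  let ?KK = "tensor_K_matrix H R \<psi> K" and ?g2 = "pure3 1 g 1" and ?g3 = "pure3 1 1 g"
  have *: "?g2 * leg23 H (tensor_map H \<psi> id X) = leg23 H (tensor_map H \<psi>g id X) * ?g2" for X
    by (induction X rule: Sq.tensor_induct)
      (simp_all add: tensor_map_id_ten tensor_map_id_add psi_g_linear psi_linear leg23_ten leg23_add
        ten_mults psi_g distrib_left distrib_right)
  have gg: "leg23 H (g \<boxtimes> g) = ?g3 * ?g2"
    by (simp add: leg23_ten ten_mults)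
  have "id_comult H Z = leg23 H Q * leg23 H (g \<boxtimes> g) * (leg23 H J * id_comult H ?KK)"
    by (simp add: Z_def id_comult_mult id_comult_ten comult_g mult.assoc leg23_mult flip: leg23_put23)
  also have "\<dots> = leg23 H Q * ?g3 * (?g2 * leg13 H ?KK) * leg23 H R\<psi> * leg12 H ?KK"
    by (simp add: id_comult_tensor_K_matrix[OF assms(1)] gg mult.assoc)
  also have "\<dots> = leg23 H Q * ?g3 * leg13 H ?KK * (?g2 * leg23 H R\<psi>) * leg12 H ?KK"
    by (simp add: leg2_commute[symmetric] mult.assoc)
  also have "\<dots> = leg23 H Q * (?g3 * leg13 H ?KK) * leg23 H (tensor_map H \<psi>g id R) * (?g2 * leg12 H ?KK)"
    by (simp add: * mult.assoc)
  also have "?g3 * leg13 H ?KK = leg13 H Z"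
    by (simp add: Z_def leg13_mult leg13_ten)
  also have "?g2 * leg12 H ?KK = leg12 H Z"
    by (simp add: Z_def leg12_mult leg12_ten)
  finally show ?thesis .
qed

text \<open>On pure tensors \<open>X = k \<otimes> l\<close> and \<open>Y = k' \<otimes> l'\<close> everything but \<open>k k'\<close> is a scalar, and the R-matrices
  inside it cancel under the traces. The factors come out in the order opposite to
  \<open>\<chi>\<close>, \<open>\<chi>'\<close>.\<close>

lemma slice23_fused:
  assumes "trace_form \<chi>" "trace_form \<chi>'"
  shows "slice23 \<chi> \<chi>' (leg23 H Q * leg13 H X * leg23 H (tensor_map H \<psi>g id R) * leg12 H Y)
    = slice \<chi>' X * slice \<chi> Y"
proof -
  have lin: "lin_form \<chi>" "lin_form \<chi>'" using assms by (auto simp: trace_form_def)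
  have pair: "pairing \<chi> \<chi>' (Q * (1 \<boxtimes> l) * tensor_map H \<psi>g id R * (l' \<boxtimes> 1)) = \<chi> l' * \<chi>' l" for l l'
  proof -
    have l1: "lin_form (\<lambda>x. \<chi> (\<psi>g x * l'))"
      by (rule linearI) (simp_all only: vector_spaces lin_simps linear_addD[OF psi_g_linear] linear_scaleD[OF psi_g_linear]
          linear_addD[OF lin(1)] linear_scaleD[OF lin(1)])
    have l2: "lin_form (\<lambda>y. \<chi>' (y * l))"
      by (rule linearI) (simp_all add: vector_spaces lin_simps linear_addD[OF lin(2)] linear_scaleD[OF lin(2)])
    have "pairing (\<lambda>x. \<chi> (\<psi>g x * l')) (\<lambda>y. \<chi>' (y * l)) (1 \<boxtimes> 1) = \<chi> l' * \<chi>' l"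
      by (subst pairing_ten[OF l1 l2]) (simp only: psi_g_one mult_1_left)
    then show ?thesis
      by (simp only: pairing_contract_right[OF lin(1) assms(2) psi_g_linear psi_g_mult]
          contract_right_R Sq.ten_one)
  qed
  have 13: "leg13 H (k \<boxtimes> l) = put23 k (1 \<boxtimes> l)" and 12: "leg12 H (k \<boxtimes> l) = put23 k (l \<boxtimes> 1)" for k l
    by (simp_all add: leg13_ten leg12_ten put23_ten)
  show ?thesis
  proof (induction X Y rule: tensor_induct2)
    case (pure k l k' l')
    show ?case
      by (simp only: 13 12 leg23_put23 put23_mult slice23_put23[OF lin] mult_1_left mult_1_right pair
          slice_ten lin)
        (simp add: lin_simps mult.commute)
  qed (simp_all add: leg13_add leg12_add slice23_add lin slice_add distrib_left distrib_right)
qed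

text \<open>The fusion relation reverses the order of the two factors; exchanging the two trace forms first
  restores it.\<close>

lemma transfer_convolution:
  assumes "K_matrix K" and \<chi>: "trace_form \<chi>" and \<chi>': "trace_form \<chi>'"
  shows "transfer_matrix K (\<lambda>y. pairing \<chi> \<chi>' (\<Delta> y)) = transfer_matrix K \<chi> * transfer_matrix K \<chi>'"
proof -
  have lin: "lin_form \<chi>" "lin_form \<chi>'" using assms by (auto simp: trace_form_def)
  have "pairing \<chi> \<chi>' (\<Delta> y) = pairing \<chi>' \<chi> (\<Delta> y)" for y
    using \<chi> \<chi>' by (intro pairing_comult_commute) (auto simp: trace_form_def)
  then have "transfer_matrix K (\<lambda>y. pairing \<chi> \<chi>' (\<Delta> y)) = transfer_matrix K (\<lambda>y. pairing \<chi>' \<chi> (\<Delta> y))"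
    by simp
  also have "\<dots> = transfer_matrix K \<chi> * transfer_matrix K \<chi>'"
    unfolding transfer_matrix_def slice_convolution[OF lin(2,1)]
    by (subst id_comult_gauged_K[OF assms(1)]) (rule slice23_fused[OF \<chi>' \<chi>])
  finally show ?thesis .
qed

lemma transfer_counit:
  assumes "K_matrix K"
  shows "transfer_matrix K \<epsilon> = 1"
proof -
  have "sc (\<epsilon> D) D = 1 * D"
    using counit_right[of D] by (simp add: D_grouplike id_counit_ten)
  then have "sc (\<epsilon> D) 1 * D = 1 * D" by (simp add: lin_simps)
  then have "sc (\<epsilon> D) 1 = 1" by (metis D_invertible elt_inverse_cancel(3))
  then have "\<epsilon> (sc (\<epsilon> D) 1) = \<epsilon> 1" by simp
  then have "\<epsilon> D = 1" by (simp add: lin_simps counit_one)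
  then have "\<epsilon> g = 1"
    using arg_cong[OF g_K', of \<epsilon>] K_matrix_counit(1)[OF K'] by (simp add: counit_mult)
  then show ?thesis
    using K_matrix_counit[OF assms]
    by (simp add: transfer_matrix_def tensor_K_matrix_def id_counit_mult id_counit_flip id_counit_ten id_counit_R
        flip: id_counit_slice)
qed

end

section \<open>Kronecker products\<close>

lemma sum_div_mod:
  fixes f :: "nat \<Rightarrow> nat \<Rightarrow> 'v::comm_monoid_add"
  shows "(\<Sum>k<n * m. f (k div m) (k mod m)) = (\<Sum>i<n. \<Sum>j<m. f i j)"
proof -
  have "bij_betw (\<lambda>k. (k div m, k mod m)) {..<n * m} ({..<n} \<times> {..<m})"
  proof (rule bij_betwI[where g = "\<lambda>(i, j). i * m + j"])
    show "(\<lambda>k. (k div m, k mod m)) \<in> {..<n * m} \<rightarrow> {..<n} \<times> {..<m}"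
      by (cases "m = 0") (auto simp: less_mult_imp_div_less)
    show "(\<lambda>(i, j). i * m + j) \<in> {..<n} \<times> {..<m} \<rightarrow> {..<n * m}"
    proof (clarsimp)
      fix i j assume "i < n" "j < m"
      then have "i * m + j < Suc i * m" by simp
      also have "\<dots> \<le> n * m" using \<open>i < n\<close> by (intro mult_right_mono) auto
      finally show "i * m + j < n * m" .
    qed
  qed auto
  from sum.reindex_bij_betw[OF this, of "\<lambda>(i, j). f i j"] show ?thesis
    by (simp add: sum.cartesian_product)
qed

lemma kronecker_carrier:
  assumes "A \<in> carrier_mat n n" "B \<in> carrier_mat m m"
  shows "kronecker A B \<in> carrier_mat (n * m) (n * m)"
  using assms by (auto simp: kronecker_def)

lemma kronecker_index:
  assumes "A \<in> carrier_mat n n" "B \<in> carrier_mat m m" "r < n * m" "c < n * m"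
  shows "kronecker A B $$ (r, c) = A $$ (r div m, c div m) * B $$ (r mod m, c mod m)"
  using assms by (auto simp: kronecker_def)

lemma div_mod_bounds:
  fixes r n m :: nat
  assumes "r < n * m"
  shows "r div m < n" "r mod m < m"
  using assms by (cases "m = 0"; simp add: less_mult_imp_div_less)+

lemma kronecker_mult:
  fixes A B C D :: "'k::comm_semiring_0 mat"
  assumes "A \<in> carrier_mat n n" "B \<in> carrier_mat m m" "C \<in> carrier_mat n n" "D \<in> carrier_mat m m"
  shows "kronecker A B * kronecker C D = kronecker (A * C) (B * D)"
proof (rule eq_matI)
  note c = kronecker_carrier[OF assms(1,2)] kronecker_carrier[OF assms(3,4)]
    kronecker_carrier[OF mult_carrier_mat[OF assms(1,3)] mult_carrier_mat[OF assms(2,4)]]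
  fix r s
  assume "r < dim_row (kronecker (A * C) (B * D))" "s < dim_col (kronecker (A * C) (B * D))"
  then have rs: "r < n * m" "s < n * m" using c by auto
  note b = div_mod_bounds[OF rs(1)] div_mod_bounds[OF rs(2)]
  have "(kronecker A B * kronecker C D) $$ (r, s)
      = (\<Sum>k<n * m. kronecker A B $$ (r, k) * kronecker C D $$ (k, s))"
    using c rs by (simp add: scalar_prod_def atLeast0LessThan)
  also have "\<dots> = (\<Sum>k<n * m. (A $$ (r div m, k div m) * B $$ (r mod m, k mod m)) *
      (C $$ (k div m, s div m) * D $$ (k mod m, s mod m)))"
    by (rule sum.cong) (auto simp: kronecker_index[OF assms(1,2)] kronecker_index[OF assms(3,4)] rs)
  also have "\<dots> = (\<Sum>i<n. \<Sum>j<m. (A $$ (r div m, i) * B $$ (r mod m, j)) * (C $$ (i, s div m) * D $$ (j, s mod m)))"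
    by (rule sum_div_mod)
  also have "\<dots> = (\<Sum>i<n. A $$ (r div m, i) * C $$ (i, s div m)) * (\<Sum>j<m. B $$ (r mod m, j) * D $$ (j, s mod m))"
    by (simp add: sum_product mult_ac)
  also have "\<dots> = kronecker (A * C) (B * D) $$ (r, s)"
    using assms b by (subst kronecker_index[OF mult_carrier_mat[OF assms(1,3)] mult_carrier_mat[OF assms(2,4)] rs])
      (simp add: scalar_prod_def atLeast0LessThan)
  finally show "(kronecker A B * kronecker C D) $$ (r, s) = kronecker (A * C) (B * D) $$ (r, s)" .
qed (use assms in \<open>auto simp: kronecker_def\<close>)

lemma kronecker_one: "kronecker (1\<^sub>m n) (1\<^sub>m m) = (1\<^sub>m (n * m) :: 'k::semiring_1 mat)"
proof (rule eq_matI)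
  fix r c
  assume "r < dim_row (1\<^sub>m (n * m))" "c < dim_col (1\<^sub>m (n * m))"
  then have rs: "r < n * m" "c < n * m" by auto
  note b = div_mod_bounds[OF rs(1)] div_mod_bounds[OF rs(2)]
  have "r = c \<longleftrightarrow> r div m = c div m \<and> r mod m = c mod m"
    by (metis div_mult_mod_eq)
  then show "kronecker (1\<^sub>m n) (1\<^sub>m m) $$ (r, c) = (1\<^sub>m (n * m) :: 'k mat) $$ (r, c)"
    using rs b by (subst kronecker_index) auto
qed (auto simp: kronecker_def)

lemma kronecker_trace:
  fixes A B :: "'k::comm_semiring_0 mat"
  assumes "A \<in> carrier_mat n n" "B \<in> carrier_mat m m"
  shows "(\<Sum>r<n * m. kronecker A B $$ (r, r)) = (\<Sum>i<n. A $$ (i, i)) * (\<Sum>j<m. B $$ (j, j))"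
  by (simp add: kronecker_index[OF assms] sum_div_mod[of "\<lambda>i j. A $$ (i, i) * B $$ (j, j)"] sum_product)

section \<open>Actions on tensor products of modules\<close>

context hopf_algebra
begin

definition lin_mat :: "nat \<Rightarrow> ('a \<Rightarrow> 'k mat) \<Rightarrow> bool" where
  "lin_mat n V \<longleftrightarrow> (\<forall>a. V a \<in> carrier_mat n n) \<and> (\<forall>a b. V (a + b) = V a + V b) \<and>
     (\<forall>c a. V (sc c a) = c \<cdot>\<^sub>m V a)"

lemma lin_matD:
  assumes "lin_mat n V"
  shows "V a \<in> carrier_mat n n" "dim_row (V a) = n" "dim_col (V a) = n" "mdim V = n"
    "V (a + b) = V a + V b" "V (sc c a) = c \<cdot>\<^sub>m V a"
  using assms by (auto simp: lin_mat_def mdim_def)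

lemma lin_mat_transpose:
  assumes "lin_mat n V"
  shows "lin_mat n (\<lambda>a. transpose_mat (V a))"
proof -
  note d = lin_matD[OF assms]
  have "transpose_mat (c \<cdot>\<^sub>m V a) = c \<cdot>\<^sub>m transpose_mat (V a)" for c a
    by (rule eq_matI) (simp_all add: d)
  then show ?thesis
    by (simp add: lin_mat_def d transpose_add[OF d(1) d(1)])
qed

lemma lin_mat_comp: "lin_mat n V \<Longrightarrow> lin_A f \<Longrightarrow> lin_mat n (\<lambda>a. V (f a))"
  by (simp add: lin_mat_def linear_addD[of sc sc] linear_scaleD[of sc sc])

lemma bilin_kronecker:
  assumes V: "lin_mat n V" and W: "lin_mat m W" and rc: "r < n * m" "c < n * m"
  shows "bilin sc sc (*) (\<lambda>x y. kronecker (V x) (W y) $$ (r, c))"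
proof -
  note d = lin_matD[OF V] lin_matD[OF W]
  note b = div_mod_bounds[OF rc(1)] div_mod_bounds[OF rc(2)]
  have *: "kronecker (V x) (W y) $$ (r, c) = V x $$ (r div m, c div m) * W y $$ (r mod m, c mod m)" for x y
    by (rule kronecker_index) (use d rc in auto)
  show ?thesis
    unfolding * by (rule bilinI) (use d b in \<open>simp_all add: vector_spaces algebra_simps\<close>)
qed

lemma act2_carrier: "lin_mat n V \<Longrightarrow> lin_mat m W \<Longrightarrow> act2 H V W T \<in> carrier_mat (n * m) (n * m)"
  by (simp add: act2_def lin_matD)

lemma act2_ten:
  assumes "lin_mat n V" "lin_mat m W"
  shows "act2 H V W (x \<boxtimes> y) = kronecker (V x) (W y)"
  using kronecker_carrier[OF lin_matD(1)[OF assms(1)] lin_matD(1)[OF assms(2)], of x y]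
  by (intro eq_matI)
    (simp_all add: act2_def lin_matD(4)[OF assms(1)] lin_matD(4)[OF assms(2)] lift2_ten[OF bilin_kronecker[OF assms]])

lemma act2_add:
  assumes "lin_mat n V" "lin_mat m W"
  shows "act2 H V W (X + Y) = act2 H V W X + act2 H V W Y"
  by (intro eq_matI)
    (simp_all add: act2_def lin_matD(4)[OF assms(1)] lin_matD(4)[OF assms(2)] lift2_add[OF bilin_kronecker[OF assms]])

lemma fd_module_lin_mat: "fd_module H V \<Longrightarrow> lin_mat (mdim V) V"
  by (auto simp: fd_module_def lin_mat_def mdim_def)

lemma fd_module_one: "fd_module H V \<Longrightarrow> V 1 = 1\<^sub>m (mdim V)"
  and fd_module_mult: "fd_module H V \<Longrightarrow> V (a * b) = V a * V b"
  by (auto simp: fd_module_def mdim_def)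

lemma fd_module_comp:
  assumes V: "fd_module H V" and f: "lin_A f" "f 1 = 1" "\<And>x y. f (x * y) = f x * f y"
  shows "fd_module H (V \<circ> f)"
  using V f unfolding fd_module_def
  by (auto simp: linear_addD[OF f(1)] linear_scaleD[OF f(1)])

lemma act2_mult:
  assumes V: "fd_module H V" and W: "fd_module H W"
  shows "act2 H V W (X * Y) = act2 H V W X * act2 H V W Y"
proof -
  note l = fd_module_lin_mat[OF V] fd_module_lin_mat[OF W]
  note c = act2_carrier[OF l]
  show ?thesis
  proof (induction X Y rule: tensor_induct2)
    case (pure x y x' y')
    show ?case
      by (simp add: act2_ten[OF l] Sq.ten_mult fd_module_mult V W
          kronecker_mult[OF lin_matD(1)[OF l(1)] lin_matD(1)[OF l(2)] lin_matD(1)[OF l(1)] lin_matD(1)[OF l(2)]])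
  next
    case (add_left X X' Y)
    then show ?case
      by (simp add: act2_add[OF l] distrib_right add_mult_distrib_mat[OF c c c])
  next
    case (add_right X Y Y')
    then show ?case
      by (simp add: act2_add[OF l] distrib_left mult_add_distrib_mat[OF c c c])
  qed
qed

lemma act2_one:
  assumes V: "fd_module H V" and W: "fd_module H W"
  shows "act2 H V W 1 = 1\<^sub>m (mdim V * mdim W)"
  using act2_ten[OF fd_module_lin_mat[OF V] fd_module_lin_mat[OF W], of 1 1]
  by (simp add: Sq.ten_one fd_module_one V W kronecker_one)

lemma act2_tensor_map:
  assumes l: "lin_mat n V" "lin_mat m W" and f: "lin_A f" and h: "lin_A h"
  shows "act2 H V W (tensor_map H f h X) = act2 H (\<lambda>x. V (f x)) (\<lambda>y. W (h y)) X"
  by (induction X rule: Sq.tensor_induct)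
    (simp_all add: tensor_map_ten tensor_map_add f h act2_ten[OF l] act2_add[OF l]
      act2_ten[OF lin_mat_comp[OF l(1) f] lin_mat_comp[OF l(2) h]]
      act2_add[OF lin_mat_comp[OF l(1) f] lin_mat_comp[OF l(2) h]])

text \<open>The partial transpose amounts to letting the second leg act by transposed matrices, which is an
  antihomomorphism of \<open>A\<close>.\<close>

lemma partial_transpose2_act2:
  assumes l: "lin_mat n V" "lin_mat m W"
  shows "partial_transpose2 m (act2 H V W T) = act2 H V (\<lambda>y. transpose_mat (W y)) T"
proof -
  note l' = lin_mat_transpose[OF l(2)]
  note d = lin_matD[OF l(1)] lin_matD[OF l(2)] lin_matD[OF l']
  have *: "kronecker (V x) (W y) $$ ((r div m) * m + c mod m, (c div m) * m + r mod m)
      = kronecker (V x) (transpose_mat (W y)) $$ (r, c)"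
    and bound: "(r div m) * m + c mod m < n * m" "(c div m) * m + r mod m < n * m"
    if rc: "r < n * m" "c < n * m" for r c x y
  proof -
    note b = div_mod_bounds[OF rc(1)] div_mod_bounds[OF rc(2)]
    have "i * m + j < n * m" if "i < n" "j < m" for i j
    proof -
      have "i * m + j < Suc i * m" using that by simp
      also have "\<dots> \<le> n * m" using \<open>i < n\<close> by (intro mult_right_mono) auto
      finally show ?thesis .
    qed
    then show bound: "(r div m) * m + c mod m < n * m" "(c div m) * m + r mod m < n * m"
      using b by auto
    show "kronecker (V x) (W y) $$ ((r div m) * m + c mod m, (c div m) * m + r mod m)
      = kronecker (V x) (transpose_mat (W y)) $$ (r, c)"
      using b d
      by (subst kronecker_index[OF d(1) d(7) bound], subst kronecker_index[OF d(1) d(13) rc]) simp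
  qed
  show ?thesis
    by (intro eq_matI)
      (simp_all add: partial_transpose2_def act2_def d(4,10,16) bound *)
qed

text \<open>Transposition reverses the products in the second leg, so here the antipode meets the other
  factor directly and the result is again a contraction.\<close>

lemma transposed_contract_right:
  assumes V: "fd_module H V" and W: "fd_module H W"
  shows "act2 H V (\<lambda>y. transpose_mat (W (\<S> y))) X * act2 H V (\<lambda>y. transpose_mat (W y)) Y
    = act2 H V (\<lambda>y. transpose_mat (W y)) (contract_right (leg13 H X * leg12 H Y))"
proof -
  note l = fd_module_lin_mat[OF V] lin_mat_transpose[OF fd_module_lin_mat[OF W]]
  note l' = lin_mat_comp[OF l(2) antipode_linear]
  note c = act2_carrier[OF l] and c' = act2_carrier[OF l(1) l']
  note k = kronecker_mult[OF lin_matD(1)[OF l(1)] lin_matD(1)[OF l(2)] lin_matD(1)[OF l(1)] lin_matD(1)[OF l(2)]]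
  note w = lin_matD(1)[OF fd_module_lin_mat[OF W]]
  show ?thesis
  proof (induction X Y rule: tensor_induct2)
    case (pure x z x' y)
    show ?case
      by (simp add: act2_ten[OF l] act2_ten[OF l(1) l'] k leg13_ten leg12_ten ten_mults
          contract_right_pure fd_module_mult V W transpose_mult[OF w w])
  next
    case (add_left X X' Y)
    then show ?case
      by (simp add: act2_add[OF l] act2_add[OF l(1) l'] leg13_add distrib_right contract_right_add
          add_mult_distrib_mat[OF c' c' c])
  next
    case (add_right X Y Y')
    then show ?case
      by (simp add: act2_add[OF l] act2_add[OF l(1) l'] leg12_add distrib_left contract_right_add
          mult_add_distrib_mat[OF c' c c])
  qed
qed

lemma transposed_contract_left:
  assumes V: "fd_module H V" and W: "fd_module H W"
  shows "act2 H V (\<lambda>y. transpose_mat (W y)) X * act2 H V (\<lambda>y. transpose_mat (W (\<S> y))) Y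
    = act2 H V (\<lambda>y. transpose_mat (W y)) (contract_left (leg13 H X * leg12 H Y))"
proof -
  note l = fd_module_lin_mat[OF V] lin_mat_transpose[OF fd_module_lin_mat[OF W]]
  note l' = lin_mat_comp[OF l(2) antipode_linear]
  note c = act2_carrier[OF l] and c' = act2_carrier[OF l(1) l']
  note k = kronecker_mult[OF lin_matD(1)[OF l(1)] lin_matD(1)[OF l(2)] lin_matD(1)[OF l(1)] lin_matD(1)[OF l(2)]]
  note w = lin_matD(1)[OF fd_module_lin_mat[OF W]]
  show ?thesis
  proof (induction X Y rule: tensor_induct2)
    case (pure x z x' y)
    show ?case
      by (simp add: act2_ten[OF l] act2_ten[OF l(1) l'] k leg13_ten leg12_ten ten_mults
          contract_left_pure fd_module_mult V W transpose_mult[OF w w])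
  next
    case (add_left X X' Y)
    then show ?case
      by (simp add: act2_add[OF l] act2_add[OF l(1) l'] leg13_add distrib_right contract_left_add
          add_mult_distrib_mat[OF c c c'])
  next
    case (add_right X Y Y')
    then show ?case
      by (simp add: act2_add[OF l] act2_add[OF l(1) l'] leg12_add distrib_left contract_left_add
          mult_add_distrib_mat[OF c c' c'])
  qed
qed

section \<open>Characters\<close>

definition character :: "('a \<Rightarrow> 'k mat) \<Rightarrow> 'a \<Rightarrow> 'k" where
  "character V a = (\<Sum>i<mdim V. V a $$ (i, i))"

lemma lin_character:
  assumes "lin_mat n V"
  shows "lin_form (character V)"
  unfolding character_def
  by (rule linearI)
    (use lin_matD[OF assms] in \<open>simp_all add: vector_spaces sum.distrib sum_distrib_left\<close>)

lemma trace_form_character: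
  assumes V: "fd_module H V"
  shows "trace_form (character V)"
proof -
  note d = lin_matD[OF fd_module_lin_mat[OF V]]
  have "character V (x * y) = (\<Sum>i<mdim V. \<Sum>j<mdim V. V x $$ (i, j) * V y $$ (j, i))" for x y
    using d by (simp add: character_def fd_module_mult[OF V] scalar_prod_def atLeast0LessThan)
  then have "character V (x * y) = character V (y * x)" for x y
    by (simp only:) (subst sum.swap, simp only: mult.commute)
  then show ?thesis
    by (simp add: trace_form_def lin_character[OF fd_module_lin_mat[OF V]])
qed

lemma character_tensor_module:
  assumes V: "fd_module H V" and W: "fd_module H W"
  shows "character (tensor_module H V W) = (\<lambda>a. pairing (character V) (character W) (\<Delta> a))"
proof
  fix a
  note l = fd_module_lin_mat[OF V] fd_module_lin_mat[OF W]
  note c = lin_character[OF l(1)] lin_character[OF l(2)]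
  have "(\<Sum>r<mdim V * mdim W. act2 H V W X $$ (r, r)) = pairing (character V) (character W) X" for X
  proof (induction X rule: Sq.tensor_induct)
    case (pure x y)
    show ?case
      by (simp add: act2_ten[OF l] pairing_ten[OF c]
          kronecker_trace[OF lin_matD(1)[OF l(1)] lin_matD(1)[OF l(2)]]) (simp add: character_def)
  next
    case (add X Y)
    then show ?case
      by (simp add: act2_add[OF l] carrier_matD[OF act2_carrier[OF l]] pairing_add[OF c] sum.distrib flip: add)
  qed
  moreover have "mdim (tensor_module H V W) = mdim V * mdim W"
    by (simp add: mdim_def tensor_module_def act2_def)
  ultimately show "character (tensor_module H V W) a = pairing (character V) (character W) (\<Delta> a)"
    by (simp add: character_def tensor_module_def)
qed

lemma character_trivial_module: "character (trivial_module H) = \<epsilon>"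
  by (rule ext) (simp add: character_def trivial_module_def mdim_def)

lemma boundary_transfer_matrix_eq_slice:
  assumes "lin_mat n V"
  shows "boundary_transfer_matrix H a KK V = slice (character V) ((1 \<boxtimes> a) * KK)"
proof -
  note d = lin_matD[OF assms]
  have b: "bilin sc sc sc (\<lambda>x y. sc (V y $$ (i, i)) x)" if "i < n" for i
    by (rule bilinI) (use d that in \<open>simp_all add: vector_spaces lin_simps mult.commute\<close>)
  have "(\<Sum>i<n. lift2 H sc (\<lambda>x y. sc (V y $$ (i, i)) x) X) = slice (character V) X" for X
  proof (induction X rule: Sq.tensor_induct)
    case (pure x y)
    have "sc (\<Sum>i<n. V y $$ (i, i)) x = (\<Sum>i<n. sc (V y $$ (i, i)) x)"
      by (rule Sq.V.scale_sum_left)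
    then show ?case
      by (simp add: lift2_ten[OF b] slice_ten[OF lin_character[OF assms]]) (simp add: character_def d)
  qed (simp add: lift2_add[OF b] slice_add[OF lin_character[OF assms]] sum.distrib)
  then show ?thesis
    by (simp add: boundary_transfer_matrix_def partial_trace2_def act_second_def d)
qed

end

section \<open>The gauge condition on modules\<close>

context boundary_hopf_algebra
begin

text \<open>The inner inverse is the partial transpose of \<open>Q\<^sub>V\<^sub>,\<^sub>W\<close>. Undoing that transpose gives \<open>Q\<^sub>V\<^sub>,\<^sub>W\<close>
  itself, whose inverse is the action of the gauged twist.\<close>

theorem boundary_gauge_transformation_g: "boundary_gauge_transformation H R \<psi> J g"
proof -
  have "\<exists>X Y. is_inverse_mat (partial_transpose2 (mdim W) (act2 H (V \<circ> \<psi>g) W R)) X \<and>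
      is_inverse_mat (partial_transpose2 (mdim W) X) Y \<and>
      act2 H V W (tensor_map H \<psi>g (\<lambda>x. \<S> (\<S> x)) R) = Y"
    if V: "fd_module H V" and W: "fd_module H W" for V W
  proof (intro exI conjI)
    let ?X = "partial_transpose2 (mdim W) (act2 H V W Q)" and ?Wt = "\<lambda>y. transpose_mat (W y)"
    let ?J = "tensor_map H \<psi>g (\<lambda>x. \<S> (\<S> x)) R"
    note l = fd_module_lin_mat[OF V] fd_module_lin_mat[OF W]
    note V\<psi> = fd_module_comp[OF V psi_g_linear psi_g_one psi_g_mult]
    note l\<psi> = fd_module_lin_mat[OF V\<psi>]
    have dim: "mdim (V \<circ> \<psi>g) = mdim V"
      using lin_matD(4)[OF lin_mat_comp[OF l(1) psi_g_linear]] by (simp add: comp_def)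
    have X: "?X = act2 H (V \<circ> \<psi>g) (\<lambda>y. transpose_mat (W (\<S> y))) R"
      by (simp add: partial_transpose2_act2[OF l] comp_def
          act2_tensor_map[OF l(1) lin_mat_transpose[OF l(2)] psi_g_linear antipode_linear])
    have one: "act2 H (V \<circ> \<psi>g) ?Wt 1 = 1\<^sub>m (mdim V * mdim W)"
      using act2_ten[OF l\<psi> lin_mat_transpose[OF l(2)], of 1 1]
      by (simp add: Sq.ten_one kronecker_one fd_module_one V W psi_g_one)
    show "is_inverse_mat (partial_transpose2 (mdim W) (act2 H (V \<circ> \<psi>g) W R)) ?X"
      using act2_carrier[OF l\<psi> lin_mat_transpose[OF l(2)], of R]
        act2_carrier[OF l\<psi> lin_mat_comp[OF lin_mat_transpose[OF l(2)] antipode_linear], of R]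
      by (simp add: is_inverse_mat_def inverts_mat_def partial_transpose2_act2[OF l\<psi> l(2)] X dim one
          transposed_contract_left[OF V\<psi> W] transposed_contract_right[OF V\<psi> W]
          contract_left_R contract_right_R)
    have "partial_transpose2 (mdim W) ?X = act2 H V W Q"
      by (simp add: partial_transpose2_act2[OF l] partial_transpose2_act2[OF l(1) lin_mat_transpose[OF l(2)]])
    then show "is_inverse_mat (partial_transpose2 (mdim W) ?X) (act2 H V W ?J)"
      using act2_carrier[OF l, of Q] act2_carrier[OF l, of ?J]
      by (simp add: is_inverse_mat_def inverts_mat_def gauged_J_inverse act2_one V W
          flip: act2_mult[OF V W])
  qed (rule refl)
  then show ?thesis
    unfolding boundary_gauge_transformation_def Let_def gauged_J_eq \<psi>g_def[symmetric]
    using g_invertible by blast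
qed

end

section \<open>Characters of short exact sequences\<close>

lemma trace_mult_commute:
  fixes A B :: "'k::comm_semiring_0 mat"
  assumes "A \<in> carrier_mat n m" "B \<in> carrier_mat m n"
  shows "(\<Sum>i<n. (A * B) $$ (i, i)) = (\<Sum>j<m. (B * A) $$ (j, j))"
proof -
  have "(\<Sum>i<n. (A * B) $$ (i, i)) = (\<Sum>i<n. \<Sum>j<m. A $$ (i, j) * B $$ (j, i))"
    using assms by (simp add: scalar_prod_def atLeast0LessThan)
  also have "\<dots> = (\<Sum>j<m. \<Sum>i<n. B $$ (j, i) * A $$ (i, j))"
    by (subst sum.swap) (simp only: mult.commute)
  also have "\<dots> = (\<Sum>j<m. (B * A) $$ (j, j))"
    using assms by (simp add: scalar_prod_def atLeast0LessThan)
  finally show ?thesis .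
qed

text \<open>Used to lift the identity along a surjection and to factor through an injection, one column at a
  time.\<close>

lemma factor_through_columns:
  assumes f: "f \<in> carrier_mat n m" and X: "X \<in> carrier_mat n k"
    and cols: "\<And>j. j < k \<Longrightarrow> col X j \<in> (*\<^sub>v) f ` carrier_vec m"
  shows "\<exists>Y \<in> carrier_mat m k. f * Y = X"
proof -
  have "\<forall>j\<in>{..<k}. \<exists>v. v \<in> carrier_vec m \<and> f *\<^sub>v v = col X j"
    using cols by (metis imageE lessThan_iff)
  then obtain v where v: "\<And>j. j < k \<Longrightarrow> v j \<in> carrier_vec m \<and> f *\<^sub>v v j = col X j"
    by (metis lessThan_iff)
  let ?Y = "mat m k (\<lambda>(i, j). v j $ i)"
  have "f * ?Y = X"
  proof (rule eq_matI)
    fix i j assume "i < dim_row X" "j < dim_col X"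
    then have ij: "i < n" "j < k" using X by auto
    have "col ?Y j = v j" using v[OF ij(2)] ij by (intro eq_vecI) auto
    then have "(f * ?Y) $$ (i, j) = (f *\<^sub>v v j) $ i" using ij f by simp
    then show "(f * ?Y) $$ (i, j) = X $$ (i, j)" using v[OF ij(2)] ij X by simp
  qed (use f X in auto)
  then show ?thesis by (intro bexI[of _ ?Y]) auto
qed

lemma cancel_injective:
  assumes f: "f \<in> carrier_mat n m" and inj: "inj_on ((*\<^sub>v) f) (carrier_vec m)"
    and A: "A \<in> carrier_mat m k" and B: "B \<in> carrier_mat m k" and eq: "f * A = f * B"
  shows "A = B"
proof (rule mat_col_eqI)
  fix j assume j: "j < dim_col B"
  then have "f *\<^sub>v col A j = f *\<^sub>v col B j"
    using f A B eq by (metis carrier_matD(2) col_mult2)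
  then show "col A j = col B j"
    using inj_onD[OF inj] A B j by (metis carrier_matD(1) carrier_vecI dim_col)
qed (use A B in auto)

context hopf_algebra
begin

text \<open>A right inverse \<open>s\<close> of the quotient map \<open>p\<close> splits the sequence linearly: \<open>f r + s p = 1\<close> with
  \<open>r f = 1\<close>. Inserting this into \<open>tr V(a)\<close> and using that \<open>f\<close> and \<open>p\<close> are equivariant gives the two
  traces by cyclicity.\<close>

lemma character_short_exact:
  assumes "short_exact H U V W"
  shows "character V a = character U a + character W a"
proof -
  let ?u = "mdim U" and ?v = "mdim V" and ?w = "mdim W"
  from assms obtain f p where fd: "fd_module H U" "fd_module H V" "fd_module H W"
    and f: "f \<in> carrier_mat ?v ?u" and p: "p \<in> carrier_mat ?w ?v"
    and fU: "\<And>a. f * U a = V a * f" and pV: "\<And>a. p * V a = W a * p"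
    and inj: "inj_on ((*\<^sub>v) f) (carrier_vec ?u)"
    and ker: "(*\<^sub>v) f ` carrier_vec ?u = mat_kernel p"
    and surj: "(*\<^sub>v) p ` carrier_vec ?v = carrier_vec ?w"
    unfolding short_exact_def by blast
  note cU = lin_matD(1)[OF fd_module_lin_mat[OF fd(1)]]
  note cV = lin_matD(1)[OF fd_module_lin_mat[OF fd(2)]]
  note cW = lin_matD(1)[OF fd_module_lin_mat[OF fd(3)]]
  obtain s where s: "s \<in> carrier_mat ?v ?w" "p * s = 1\<^sub>m ?w"
    using factor_through_columns[OF p one_carrier_mat] surj by (metis col_dim one_carrier_mat carrier_matD(1))
  note sp = mult_carrier_mat[OF s(1) p]
  have pk: "p * (1\<^sub>m ?v - s * p) = 0\<^sub>m ?w ?v"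
  proof -
    have "p * (1\<^sub>m ?v - s * p) = p * 1\<^sub>m ?v - p * (s * p)"
      by (rule mult_minus_distrib_mat[OF p one_carrier_mat sp])
    also have "p * (s * p) = p"
      using assoc_mult_mat[OF p s(1) p] s(2) p by simp
    finally show ?thesis using p by simp
  qed
  have compl: "1\<^sub>m ?v - s * p \<in> carrier_mat ?v ?v"
    by (rule minus_carrier_mat[OF sp])
  have "\<exists>r \<in> carrier_mat ?u ?v. f * r = 1\<^sub>m ?v - s * p"
  proof (rule factor_through_columns[OF f compl])
    fix j assume j: "j < ?v"
    have "p *\<^sub>v col (1\<^sub>m ?v - s * p) j = col (p * (1\<^sub>m ?v - s * p)) j"
      by (rule col_mult2[OF p compl j, symmetric])
    also have "\<dots> = 0\<^sub>v ?w" using j by (simp add: pk)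
    finally have "p *\<^sub>v col (1\<^sub>m ?v - s * p) j = 0\<^sub>v ?w" .
    then show "col (1\<^sub>m ?v - s * p) j \<in> (*\<^sub>v) f ` carrier_vec ?u"
      unfolding ker by (rule mat_kernelI[OF p col_carrier_vec[OF j compl]])
  qed
  then obtain r where r: "r \<in> carrier_mat ?u ?v" "f * r = 1\<^sub>m ?v - s * p" by blast
  have split: "f * r + s * p = 1\<^sub>m ?v"
  proof -
    have "1\<^sub>m ?v - M + M = 1\<^sub>m ?v" if "M \<in> carrier_mat ?v ?v" for M :: "'k mat"
      by (rule eq_matI) (use that in auto)
    then show ?thesis unfolding r(2) using sp .
  qed
  have pf: "p * f = 0\<^sub>m ?w ?u"
  proof (rule eq_matI)
    fix i j assume "i < dim_row (0\<^sub>m ?w ?u)" "j < dim_col (0\<^sub>m ?w ?u)"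
    then have ij: "i < ?w" "j < ?u" by auto
    have "col f j = f *\<^sub>v col (1\<^sub>m ?u) j"
      using col_mult2[OF f one_carrier_mat ij(2)] f by simp
    then have "col f j \<in> mat_kernel p"
      using ij(2) by (simp flip: ker)
    then have "p *\<^sub>v col f j = 0\<^sub>v ?w"
      by (rule mat_kernelD(2)[OF p])
    then have "(p *\<^sub>v col f j) $ i = 0" using ij by simp
    then show "(p * f) $$ (i, j) = 0\<^sub>m ?w ?u $$ (i, j)" using ij p f by simp
  qed (use p f in auto)
  have rf: "r * f = 1\<^sub>m ?u"
  proof (rule cancel_injective[OF f inj])
    have "f * (r * f) = (1\<^sub>m ?v - s * p) * f"
      using assoc_mult_mat[OF f r(1) f] r(2) by simp
    also have "\<dots> = 1\<^sub>m ?v * f - s * p * f"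
      by (rule minus_mult_distrib_mat[OF one_carrier_mat sp f])
    also have "s * p * f = 0\<^sub>m ?v ?u"
      using assoc_mult_mat[OF s(1) p f] s(1) pf by simp
    also have "1\<^sub>m ?v * f - 0\<^sub>m ?v ?u = f * 1\<^sub>m ?u"
      using f by (intro eq_matI) auto
    finally show "f * (r * f) = f * 1\<^sub>m ?u" .
  qed (use r f in auto)
  have "V a = V a * (f * r + s * p)"
    using cV[of a] by (simp add: split)
  also have "\<dots> = V a * (f * r) + V a * (s * p)"
    by (rule mult_add_distrib_mat[OF cV mult_carrier_mat[OF f r(1)] sp])
  also have "V a * (f * r) = f * (U a * r)"
    using assoc_mult_mat[OF cV f r(1), of a] assoc_mult_mat[OF f cU r(1), of a] fU[of a] by simp
  finally have Va: "V a = f * (U a * r) + V a * s * p"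
    using assoc_mult_mat[OF cV s(1) p, of a] by simp
  note Ur = mult_carrier_mat[OF cU r(1), of a] and Vs = mult_carrier_mat[OF cV s(1), of a]
  have "character V a = (\<Sum>i<?v. (f * (U a * r) + V a * s * p) $$ (i, i))"
    by (simp add: character_def flip: Va)
  also have "\<dots> = (\<Sum>i<?v. (f * (U a * r)) $$ (i, i)) + (\<Sum>i<?v. (V a * s * p) $$ (i, i))"
    unfolding sum.distrib[symmetric]
    by (intro sum.cong refl index_add_mat(1))
      (simp_all only: carrier_matD[OF mult_carrier_mat[OF Vs p]] lessThan_iff)
  also have "(\<Sum>i<?v. (f * (U a * r)) $$ (i, i)) = (\<Sum>i<?u. (U a * r * f) $$ (i, i))"
    by (rule trace_mult_commute[OF f Ur])
  also have "U a * r * f = U a"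
    using assoc_mult_mat[OF cU r(1) f, of a] rf cU[of a] by simp
  also have "(\<Sum>i<?v. (V a * s * p) $$ (i, i)) = (\<Sum>i<?w. (p * (V a * s)) $$ (i, i))"
    by (rule trace_mult_commute[OF Vs p])
  also have "p * (V a * s) = W a"
    using assoc_mult_mat[OF p cV s(1), of a] assoc_mult_mat[OF cW p s(1), of a] pV[of a] s(2) cW[of a] by simp
  finally show ?thesis by (simp add: character_def)
qed

end

section \<open>Homomorphisms out of the Grothendieck ring\<close>

definition free_extend :: "('x \<Rightarrow> 'r::ring_1) \<Rightarrow> ('x \<Rightarrow>\<^sub>0 int) \<Rightarrow> 'r" where
  "free_extend t x = (\<Sum>V\<in>Poly_Mapping.keys x. of_int (Poly_Mapping.lookup x V) * t V)"

lemma free_extend_superset: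
  assumes "finite X" "Poly_Mapping.keys x \<subseteq> X"
  shows "free_extend t x = (\<Sum>V\<in>X. of_int (Poly_Mapping.lookup x V) * t V)"
  unfolding free_extend_def
  by (rule sum.mono_neutral_left) (use assms in \<open>auto simp: in_keys_iff\<close>)

lemma free_extend_add: "free_extend t (x + y) = free_extend t x + free_extend t y"
proof -
  let ?X = "Poly_Mapping.keys x \<union> Poly_Mapping.keys y"
  have "Poly_Mapping.keys (x + y) \<subseteq> ?X" by (rule Poly_Mapping.keys_add)
  then show ?thesis
    by (simp add: free_extend_superset[of ?X] lookup_add distrib_right sum.distrib)
qed

lemma free_extend_zero: "free_extend t 0 = 0"
  by (simp add: free_extend_def)

lemma free_extend_uminus: "free_extend t (- x) = - free_extend t x"
  using free_extend_add[of t x "- x"] by (simp add: free_extend_zero add_eq_0_iff)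

lemma free_extend_diff: "free_extend t (x - y) = free_extend t x - free_extend t y"
  using free_extend_add[of t x "- y"] by (simp add: free_extend_uminus)

lemma free_extend_sum: "free_extend t (\<Sum>i\<in>I. x i) = (\<Sum>i\<in>I. free_extend t (x i))"
  by (induction I rule: infinite_finite_induct) (simp_all add: free_extend_zero free_extend_add)

lemma free_extend_single: "free_extend t (Poly_Mapping.single V n) = of_int n * t V"
  by (simp add: free_extend_def)

context hopf_algebra
begin

lemma carrier_free_module_ring:
  "x \<in> carrier (free_module_ring H) \<longleftrightarrow> Poly_Mapping.keys x \<subseteq> {V. fd_module H V}"
  by (simp add: free_module_ring_def)

lemma free_extend_mult:
  assumes "x \<in> carrier (free_module_ring H)" "y \<in> carrier (free_module_ring H)"
    and t: "\<And>V W. fd_module H V \<Longrightarrow> fd_module H W \<Longrightarrow> t (tensor_module H V W) = t V * t W"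
  shows "free_extend t (x \<otimes>\<^bsub>free_module_ring H\<^esub> y) = free_extend t x * free_extend t y"
proof -
  have "free_extend t (x \<otimes>\<^bsub>free_module_ring H\<^esub> y) =
      (\<Sum>V\<in>Poly_Mapping.keys x. \<Sum>W\<in>Poly_Mapping.keys y.
        of_int (Poly_Mapping.lookup x V * Poly_Mapping.lookup y W) * t (tensor_module H V W))"
    by (simp add: free_module_ring_def free_extend_sum free_extend_single)
  also have "\<dots> = (\<Sum>V\<in>Poly_Mapping.keys x. \<Sum>W\<in>Poly_Mapping.keys y.
      (of_int (Poly_Mapping.lookup x V) * t V) * (of_int (Poly_Mapping.lookup y W) * t W))"
  proof (intro sum.cong refl)
    fix V W assume "V \<in> Poly_Mapping.keys x" "W \<in> Poly_Mapping.keys y"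
    then have "fd_module H V" "fd_module H W"
      using assms(1,2) by (auto simp: carrier_free_module_ring)
    then show "of_int (Poly_Mapping.lookup x V * Poly_Mapping.lookup y W) * t (tensor_module H V W) =
        (of_int (Poly_Mapping.lookup x V) * t V) * (of_int (Poly_Mapping.lookup y W) * t W)"
      by (simp add: t mult.assoc) (metis mult.assoc mult_of_int_commute)
  qed
  finally show ?thesis by (simp add: free_extend_def sum_product)
qed

text \<open>The inverse in the additive monoid is defined by description, so it is first identified with the
  negative of finitely supported functions.\<close>

lemma exact_relations_carrier_kernel:
  assumes t: "\<And>U V W. short_exact H U V W \<Longrightarrow> t V = t U + t W" and x: "x \<in> exact_relations H"
  shows "x \<in> carrier (free_module_ring H) \<and> free_extend t x = 0"
proof -
  let ?F = "free_module_ring H"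
  let ?G = "{Poly_Mapping.single V 1 - Poly_Mapping.single U 1 - Poly_Mapping.single W (1::int) | U V W.
      short_exact H U V W}"
  have gen: "y \<in> carrier ?F \<and> free_extend t y = 0" if "y \<in> ?G" for y
  proof -
    from that obtain U V W where ex: "short_exact H U V W"
      and y: "y = Poly_Mapping.single V 1 - Poly_Mapping.single U 1 - Poly_Mapping.single W 1" by blast
    have "fd_module H U" "fd_module H V" "fd_module H W" using ex by (auto simp: short_exact_def)
    moreover have "Poly_Mapping.keys y \<subseteq> {U, V, W}"
      unfolding y by (auto simp: in_keys_iff lookup_minus lookup_single when_def split: if_splits)
    ultimately have "y \<in> carrier ?F" by (auto simp: carrier_free_module_ring)
    then show ?thesis by (simp add: y free_extend_diff free_extend_single t[OF ex])
  qed
  have inv_eq: "inv\<^bsub>add_monoid ?F\<^esub> y = - y" if "y \<in> carrier ?F" for y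
    unfolding m_inv_def
  proof (rule the_equality)
    show "- y \<in> carrier (add_monoid ?F) \<and> y \<otimes>\<^bsub>add_monoid ?F\<^esub> - y = \<one>\<^bsub>add_monoid ?F\<^esub> \<and>
        - y \<otimes>\<^bsub>add_monoid ?F\<^esub> y = \<one>\<^bsub>add_monoid ?F\<^esub>"
      using that by (simp add: carrier_free_module_ring) (simp add: free_module_ring_def)
  qed (auto simp: free_module_ring_def eq_neg_iff_add_eq_0)
  show ?thesis
    using x unfolding exact_relations_def
  proof (induction rule: generate.induct)
    case one
    then show ?case by (simp add: free_module_ring_def free_extend_zero)
  next
    case (incl h)
    then show ?case by (rule gen)
  next
    case (inv h)
    note h = gen[OF inv]
    show ?case
      unfolding inv_eq[OF conjunct1[OF h]] using h
      by (simp add: free_extend_uminus carrier_free_module_ring)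
  next
    case (eng h1 h2)
    have "h1 \<otimes>\<^bsub>add_monoid ?F\<^esub> h2 = h1 + h2" by (simp add: free_module_ring_def)
    with eng show ?case
      using Poly_Mapping.keys_add[of h1 h2] by (auto simp: carrier_free_module_ring free_extend_add)
  qed
qed

lemma zero_exact_relations: "0 \<in> exact_relations H"
proof -
  have "\<one>\<^bsub>add_monoid (free_module_ring H)\<^esub> \<in> exact_relations H"
    unfolding exact_relations_def by (rule generate.one)
  then show ?thesis by (simp add: free_module_ring_def)
qed

lemma mem_coset:
  "y \<in> exact_relations H +>\<^bsub>free_module_ring H\<^esub> x \<longleftrightarrow> (\<exists>i \<in> exact_relations H. y = i + x)"
  by (auto simp: a_r_coset_def r_coset_def free_module_ring_def)

text \<open>The value at a coset is read off from a chosen representative. The product of two cosets is the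
  union of the cosets of all products of representatives. The additive extension of \<open>t\<close> is
  constant on that union, since it is multiplicative on the free ring and vanishes on the exact
  relations.\<close>

lemma grothendieck_ring_hom_exists:
  fixes t :: "('a \<Rightarrow> 'k mat) \<Rightarrow> 'a"
  assumes B: "right_coideal_subalgebra H B"
    and t_mem: "\<And>V. fd_module H V \<Longrightarrow> t V \<in> B"
    and t_exact: "\<And>U V W. short_exact H U V W \<Longrightarrow> t V = t U + t W"
    and t_mult: "\<And>V W. fd_module H V \<Longrightarrow> fd_module H W \<Longrightarrow> t (tensor_module H V W) = t V * t W"
    and t_one: "t (trivial_module H) = 1"
  shows "\<exists>h \<in> Ring.ring_hom (grothendieck_ring H) (subalgebra_ring B).
    \<forall>V. fd_module H V \<longrightarrow> h (module_class H V) = t V"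
proof -
  let ?F = "free_module_ring H" and ?I = "exact_relations H" and ?e = "free_extend t"
  define h where "h X = ?e (SOME x. x \<in> X)" for X
  have h: "h X = v" if "x \<in> X" "\<And>y. y \<in> X \<Longrightarrow> ?e y = v" for X v x
    unfolding h_def by (rule that(2)) (rule someI[of "\<lambda>x. x \<in> X", OF that(1)])
  have I: "i \<in> carrier ?F" "?e i = 0" if "i \<in> ?I" for i
    using exact_relations_carrier_kernel[OF t_exact that] by auto
  have self: "x \<in> ?I +>\<^bsub>?F\<^esub> x" for x
    using zero_exact_relations by (auto simp: mem_coset)
  have coset: "?e y = ?e x" if "y \<in> ?I +>\<^bsub>?F\<^esub> x" for x y
    using that I by (auto simp: mem_coset free_extend_add)
  have h_coset: "h (?I +>\<^bsub>?F\<^esub> x) = ?e x" for x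
    by (rule h[OF self coset])
  have coset_carrier: "y \<in> carrier ?F" if "y \<in> ?I +>\<^bsub>?F\<^esub> x" "x \<in> carrier ?F" for x y
    using that I Poly_Mapping.keys_add by (fastforce simp: mem_coset carrier_free_module_ring)
  have carrier: "\<exists>x \<in> carrier ?F. X = ?I +>\<^bsub>?F\<^esub> x" if "X \<in> carrier (grothendieck_ring H)" for X
    using that by (auto simp: grothendieck_ring_def FactRing_def A_RCOSETS_def RCOSETS_def a_r_coset_def)
  have sub: "Sq.V.subspace B" using B by (simp add: right_coideal_subalgebra_def)
  have e_mem: "?e x \<in> B" if "x \<in> carrier ?F" for x
    unfolding free_extend_def
  proof (rule Sq.V.subspace_sum[OF sub])
    fix V assume "V \<in> Poly_Mapping.keys x"
    then have "t V \<in> B" using that t_mem by (auto simp: carrier_free_module_ring)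
    have "of_int n * t V \<in> B" for n
      by (induction n rule: int_induct[where k = 0])
        (simp_all add: distrib_right left_diff_distrib \<open>t V \<in> B\<close> Sq.V.subspace_0[OF sub]
          Sq.V.subspace_add[OF sub] Sq.V.subspace_diff[OF sub])
    then show "of_int (Poly_Mapping.lookup x V) * t V \<in> B" .
  qed
  have "h \<in> Ring.ring_hom (grothendieck_ring H) (subalgebra_ring B)"
  proof (rule ring_hom_memI)
    fix X assume "X \<in> carrier (grothendieck_ring H)"
    then obtain x where "x \<in> carrier ?F" "X = ?I +>\<^bsub>?F\<^esub> x" using carrier by blast
    then show "h X \<in> carrier (subalgebra_ring B)"
      by (simp add: h_coset e_mem subalgebra_ring_def)
  next
    fix X Y assume "X \<in> carrier (grothendieck_ring H)" "Y \<in> carrier (grothendieck_ring H)"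
    then obtain x y where x: "x \<in> carrier ?F" "X = ?I +>\<^bsub>?F\<^esub> x" and y: "y \<in> carrier ?F" "Y = ?I +>\<^bsub>?F\<^esub> y"
      using carrier by blast
    have XY: "X \<otimes>\<^bsub>grothendieck_ring H\<^esub> Y = (\<Union>a\<in>X. \<Union>b\<in>Y. ?I +>\<^bsub>?F\<^esub> (a \<otimes>\<^bsub>?F\<^esub> b))"
      by (simp add: grothendieck_ring_def FactRing_def rcoset_mult_def)
    show "h (X \<otimes>\<^bsub>grothendieck_ring H\<^esub> Y) = h X \<otimes>\<^bsub>subalgebra_ring B\<^esub> h Y"
    proof (rule h)
      show "x \<otimes>\<^bsub>?F\<^esub> y \<in> X \<otimes>\<^bsub>grothendieck_ring H\<^esub> Y"
        unfolding XY using self x(2) y(2) by blast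
      fix z assume "z \<in> X \<otimes>\<^bsub>grothendieck_ring H\<^esub> Y"
      then obtain a b where ab: "a \<in> X" "b \<in> Y" "z \<in> ?I +>\<^bsub>?F\<^esub> (a \<otimes>\<^bsub>?F\<^esub> b)" unfolding XY by blast
      have "?e z = ?e a * ?e b"
        using coset[OF ab(3)] free_extend_mult[OF coset_carrier coset_carrier t_mult] ab x y by metis
      then show "?e z = h X \<otimes>\<^bsub>subalgebra_ring B\<^esub> h Y"
        using ab(1,2) coset x(2) y(2) by (simp add: subalgebra_ring_def h_coset)
    qed
    have XpY: "X \<oplus>\<^bsub>grothendieck_ring H\<^esub> Y = (\<Union>a\<in>X. \<Union>b\<in>Y. {a + b})"
      by (simp add: grothendieck_ring_def FactRing_def set_add_def set_mult_def) (simp add: free_module_ring_def)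
    show "h (X \<oplus>\<^bsub>grothendieck_ring H\<^esub> Y) = h X \<oplus>\<^bsub>subalgebra_ring B\<^esub> h Y"
    proof (rule h)
      show "x + y \<in> X \<oplus>\<^bsub>grothendieck_ring H\<^esub> Y"
        unfolding XpY using self x(2) y(2) by blast
      fix z assume "z \<in> X \<oplus>\<^bsub>grothendieck_ring H\<^esub> Y"
      then show "?e z = h X \<oplus>\<^bsub>subalgebra_ring B\<^esub> h Y"
        unfolding XpY using coset x(2) y(2) by (auto simp: subalgebra_ring_def h_coset free_extend_add)
    qed
  next
    have "\<one>\<^bsub>grothendieck_ring H\<^esub> = ?I +>\<^bsub>?F\<^esub> Poly_Mapping.single (trivial_module H) 1"
      by (simp add: grothendieck_ring_def FactRing_def) (simp add: free_module_ring_def)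
    then show "h \<one>\<^bsub>grothendieck_ring H\<^esub> = \<one>\<^bsub>subalgebra_ring B\<^esub>"
      by (simp add: h_coset free_extend_single t_one subalgebra_ring_def)
  qed
  moreover have "h (module_class H V) = t V" for V
    by (simp add: module_class_def h_coset free_extend_single)
  ultimately show ?thesis by blast
qed

end

section \<open>The ring homomorphism\<close>

context boundary_hopf_algebra
begin

theorem transfer_ring_hom:
  assumes B: "right_coideal_subalgebra H B" and K: "K_matrix K"
    and mem: "tensor_K_matrix H R \<psi> K \<in> tensor_with_A H B"
  shows "\<exists>h \<in> Ring.ring_hom (grothendieck_ring H) (subalgebra_ring B).
    \<forall>V. fd_module H V \<longrightarrow> h (module_class H V) = boundary_transfer_matrix H g (tensor_K_matrix H R \<psi> K) V"
proof -
  have "\<exists>h \<in> Ring.ring_hom (grothendieck_ring H) (subalgebra_ring B).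
    \<forall>V. fd_module H V \<longrightarrow> h (module_class H V) = transfer_matrix K (character V)"
  proof (rule grothendieck_ring_hom_exists[OF B])
    show "transfer_matrix K (character V) \<in> B" if "fd_module H V" for V
      unfolding transfer_matrix_def by (rule slice_mem[OF B mem lin_character[OF fd_module_lin_mat[OF that]]])
    show "transfer_matrix K (character V) = transfer_matrix K (character U) + transfer_matrix K (character W)"
      if "short_exact H U V W" for U V W
    proof -
      have lin: "lin_form (character U)" "lin_form (character V)" "lin_form (character W)"
        using that lin_character fd_module_lin_mat by (auto simp: short_exact_def)
      have "slice (character V) X = slice (character U) X + slice (character W) X" for X
      proof (induction X rule: Sq.tensor_induct)
        case (pure x y)
        then show ?case
          unfolding slice_ten[OF lin(1)] slice_ten[OF lin(2)] slice_ten[OF lin(3)]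
          unfolding character_short_exact[OF that]
          by (rule Sq.V.scale_left_distrib)
      next
        case (add X Y)
        then show ?case
          unfolding slice_add[OF lin(1)] slice_add[OF lin(2)] slice_add[OF lin(3)] by (simp only: add_ac)
      qed
      then show ?thesis by (simp add: transfer_matrix_def)
    qed
    show "transfer_matrix K (character (tensor_module H V W)) = transfer_matrix K (character V) * transfer_matrix K (character W)"
      if "fd_module H V" "fd_module H W" for V W
      unfolding character_tensor_module[OF that]
      by (rule transfer_convolution[OF K trace_form_character[OF that(1)] trace_form_character[OF that(2)]])
    show "transfer_matrix K (character (trivial_module H)) = 1"
      by (simp add: character_trivial_module transfer_counit[OF K])
  qed
  then show ?thesis
    using boundary_transfer_matrix_eq_slice[OF fd_module_lin_mat] by (simp add: transfer_matrix_def)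
qed

end

theorem proposition3p5p1:
  fixes H :: "('k::field, 'a::ring_1, 'b::ring_1, 'c::ring_1) hopf_data"
    and R J :: 'b and D K K' :: 'a and B :: "'a set" and \<psi> :: "'a \<Rightarrow> 'a"
  assumes "balanced_hopf_algebra H R"
    and "sovereign_element H D"
    and "right_coideal_subalgebra H B"
    and "cylindrical_structure H R B \<psi> J K"
    and "invertible_elt K'"
    and "comult H K' = elt_inverse J * tens2 H 1 K' * tensor_map H \<psi> id R * tens2 H K' 1"
  shows "boundary_gauge_transformation H R \<psi> J (D * elt_inverse K') \<and>
    (\<exists>h \<in> Ring.ring_hom (grothendieck_ring H) (subalgebra_ring B).
           \<forall>V. fd_module H V \<longrightarrow>
             h (module_class H V) =
               boundary_transfer_matrix H (D * elt_inverse K') (tensor_K_matrix H R \<psi> K) V)"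
proof -
  interpret balanced_hopf_algebra H R by fact
  interpret twisted_hopf_algebra H R \<psi> J
    by unfold_locales (use assms(4) in \<open>simp add: cylindrical_structure_def\<close>)
  interpret boundary_hopf_algebra H R \<psi> J D K'
    by unfold_locales (use assms in \<open>simp_all add: K_matrix_def\<close>)
  have "K_matrix K" "tensor_K_matrix H R \<psi> K \<in> tensor_with_A H B"
    using assms(4) by (simp_all add: K_matrix_def cylindrical_structure_def)
  with boundary_gauge_transformation_g transfer_ring_hom[OF assms(3)] show ?thesis
    by (simp add: g_def)
qed

end
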